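(* Let $\phi$ be a Ma-Minda function with Taylor expansion $\phi(z)=1+\sum_{n=1}^{\infty}B_n z^n$ in $\mathbb{D}$, with $B_n>0$ for all $n\ge 1$, and suppose $\phi\in H^2$ (the Hardy class on $\mathbb{D}$). Let $f(z)=z+\sum_{n=2}^{\infty}a_nz^n$ belong to $\mathcal{C}(\phi)$. Then $$|z|+\sum_{n=2}^{\infty}|a_n||z|^n\le d(f(0),\partial f(\mathbb{D}))$$ for $|z|=r\le\min\{r_f,1/3\}$, where $r_f$ is the smallest positive root in $(0,1)$ of the equation $k(r)+k(-1)=0$.
   Context: $\mathbb{D}=\{z\in\mathbb{C}:|z|<1\}$. $\mathcal{A}$ is the class of analytic functions $f$ in $\mathbb{D}$ with $f(0)=0$, $f'(0)=1$, and $\mathcal{S}\subseteq\mathcal{A}$ is the subclass of univalent functions. For analytic $f,g$ in $\mathbb{D}$, $f\prec g$ (subordination) means $f=g\circ\omega$ for some analytic $\omega:\mathbb{D}\to\mathbb{D}$ with $\omega(0)=0$. A Ma-Minda function is an analytic univalent function $\phi$ on $\mathbb{D}$ such that $\phi(\mathbb{D})$ lies in the right half-plane (positive real part), is symmetric with respect to the real axis and starlike with respect to $\phi(0)=1$, and $\phi'(0)>0$. $\mathcal{C}(\phi)$ is the class of $f\in\mathcal{S}$ with $1+zf''(z)/f'(z)\prec\phi(z)$. The function $k\in\mathcal{S}$ is determined by $1+zk''(z)/k'(z)=\phi(z)$, $k(0)=0$, $k'(0)=1$, and $k(-1)$ denotes $\lim_{r\to1^-}k(-r)$. $d$ is Euclidean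 distance, so $d(f(0),\partial f(\mathbb{D}))$ is the distance from the point $f(0)$ to the boundary of $f(\mathbb{D})$. *)

theory Defs
  imports "HOL-Complex_Analysis.Complex_Analysis"
begin

abbreviation unit_disc :: "complex set" ("\<bbbD>")
  where "\<bbbD> \<equiv> ball 0 1"

definition class_A :: "(complex \<Rightarrow> complex) set" where
  "class_A = {f. f holomorphic_on \<bbbD> \<and> f 0 = 0 \<and> deriv f 0 = 1}"

definition class_S :: "(complex \<Rightarrow> complex) set" where
  "class_S = {f \<in> class_A. inj_on f \<bbbD>}"

definition subordinate :: "(complex \<Rightarrow> complex) \<Rightarrow> (complex \<Rightarrow> complex) \<Rightarrow> bool"
    (infix "\<prec>\<^sub>s" 50) where
  "f \<prec>\<^sub>s g \<longleftrightarrow>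
     (\<exists>\<omega>. \<omega> holomorphic_on \<bbbD> \<and> \<omega> ` \<bbbD> \<subseteq> \<bbbD> \<and> \<omega> 0 = 0 \<and> (\<forall>z\<in>\<bbbD>. f z = g (\<omega> z)))"

definition ma_minda :: "(complex \<Rightarrow> complex) \<Rightarrow> bool" where
  "ma_minda \<phi> \<longleftrightarrow>
     \<phi> holomorphic_on \<bbbD> \<and> inj_on \<phi> \<bbbD> \<and>
     (\<forall>z\<in>\<bbbD>. Re (\<phi> z) > 0) \<and>
     cnj ` (\<phi> ` \<bbbD>) = \<phi> ` \<bbbD> \<and>
     \<phi> 0 = 1 \<and> (\<forall>w\<in>\<phi> ` \<bbbD>. closed_segment 1 w \<subseteq> \<phi> ` \<bbbD>) \<and>
     deriv \<phi> 0 \<in> \<real> \<and> Re (deriv \<phi> 0) > 0"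

text \<open>The division in \<open>convex_op\<close> is harmless on \<open>class_S\<close>: the derivative of an injective
  holomorphic function has no zeros.\<close>

definition convex_op :: "(complex \<Rightarrow> complex) \<Rightarrow> complex \<Rightarrow> complex" where
  "convex_op f z = 1 + z * deriv (deriv f) z / deriv f z"

definition class_C :: "(complex \<Rightarrow> complex) \<Rightarrow> (complex \<Rightarrow> complex) set" where
  "class_C \<phi> = {f \<in> class_S. convex_op f \<prec>\<^sub>s \<phi>}"

text \<open>The conditions determine \<open>k\<close> uniquely on the disc; its values elsewhere are never used.\<close>

definition extremal_function :: "(complex \<Rightarrow> complex) \<Rightarrow> (complex \<Rightarrow> complex) \<Rightarrow> bool" where
  "extremal_function \<phi> k \<longleftrightarrow> k \<in> class_S \<and> (\<forall>z\<in>\<bbbD>. convex_op k z = \<phi> z)"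

text \<open>The radial limit of \<open>k\<close> at \<open>-1\<close>, which need not agree with the HOL value \<open>k (-1)\<close>.\<close>

definition value_at_minus_one :: "(complex \<Rightarrow> complex) \<Rightarrow> complex" where
  "value_at_minus_one k = Lim (at_left (1::real)) (\<lambda>r. k (- of_real r))"

definition smallest_root :: "(complex \<Rightarrow> complex) \<Rightarrow> real \<Rightarrow> bool" where
  "smallest_root k r \<longleftrightarrow>
     r \<in> {0<..<1} \<and> k (of_real r) + value_at_minus_one k = 0 \<and>
     (\<forall>s\<in>{0<..<1}. k (of_real s) + value_at_minus_one k = 0 \<longrightarrow> r \<le> s)"

definition hardy_H2 :: "(complex \<Rightarrow> complex) set" where
  "hardy_H2 = {f. f holomorphic_on \<bbbD> \<and>
     bdd_above ((\<lambda>r. (1 / (2 * pi)) *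
       integral {0..2 * pi} (\<lambda>t. (norm (f (of_real r * cis t)))\<^sup>2)) ` {0..<1})}"

end

theory Submission
  imports Defs
begin

text \<open>
  Write \<open>z f'' = (\<phi> \<circ> \<omega> - 1) f'\<close> with a Schwarz function \<open>\<omega>\<close>. By Bohr's theorem for \<open>\<omega>(z)/z\<close>, the
  majorant series of \<open>\<omega>\<close> is at most \<open>r\<close> for \<open>r \<le> 1/3\<close>, so that of \<open>\<phi> \<circ> \<omega> - 1\<close> is at most \<open>\<phi>(r) - 1\<close>
  (this uses \<open>B\<^sub>n \<ge> 0\<close>). Comparing the differential equations of \<open>f'\<close> and \<open>k'\<close> bounds the majorant
  series of \<open>f'\<close> by \<open>k'(r)\<close>, hence that of \<open>f\<close> by \<open>k(r)\<close>. In the other direction \<open>\<bar>f'(z)\<bar> \<ge> k'(-\<bar>z\<bar>)\<close>,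
  and integrating along the preimage of a segment from \<open>f(0)\<close> to the nearest boundary point shows
  that the distance to the boundary is at least \<open>-k(-1)\<close>. Since \<open>k\<close> increases on \<open>[0,1)\<close>,
  \<open>k(r) \<le> -k(-1)\<close> for \<open>r \<le> r\<^sub>f\<close>. The root exists because \<open>k(r) + k(-r) \<ge> B\<^sub>1 r\<^sup>2\<close>.
\<close>

section \<open>Bohr's inequality for Schwarz functions\<close>

text \<open>Cauchy's formula for the n-th derivative on the circle of radius r, parametrised over
  \<open>{0..1}\<close> with the factor 2\<pi>i cancelled, so that coefficients become means over
  the circle.\<close>

lemma circle_mean_coeff:
  assumes "g holomorphic_on \<bbbD>" "0 < r" "r < 1"
  shows "((\<lambda>t. g (of_real r * exp (2 * of_real pi * \<i> * of_real t)) / exp (2 * of_real pi * \<i> * of_real t) ^ n)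
    has_integral fps_nth (fps_expansion g 0) n * of_real r ^ n) {0..1}"
proof -
  define E :: "real \<Rightarrow> complex" where "E t = exp (2 * of_real pi * \<i> * of_real t)" for t
  have sub: "cball 0 r \<subseteq> \<bbbD>" using assms by auto
  have "((\<lambda>u. g u / (u - 0) ^ (Suc n)) has_contour_integral
      (2 * pi * \<i> / fact n * (deriv ^^ n) g 0)) (circlepath 0 r)"
    by (rule Cauchy_has_contour_integral_higher_derivative_circlepath)
      (use assms sub in \<open>auto intro!: holomorphic_on_imp_continuous_on intro: holomorphic_on_subset\<close>)
  then have "((\<lambda>t. g (circlepath 0 r t) / circlepath 0 r t ^ Suc n
      * vector_derivative (circlepath 0 r) (at t within {0..1})) has_integral
      (2 * pi * \<i> / fact n * (deriv ^^ n) g 0)) {0..1}"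
    by (simp add: has_contour_integral_def)
  then have "((\<lambda>t. 2 * pi * \<i> / of_real r ^ n * (g (of_real r * E t) / E t ^ n)) has_integral
      (2 * pi * \<i> / fact n * (deriv ^^ n) g 0)) {0..1}"
  proof (rule has_integral_eq[rotated])
    fix t :: real assume "t \<in> {0..1}"
    then have v: "vector_derivative (circlepath 0 r) (at t within {0..1}) = 2 * pi * \<i> * r * E t"
      by (simp add: vector_derivative_circlepath01 E_def)
    have c: "circlepath 0 r t = of_real r * E t"
      by (simp add: circlepath E_def)
    show "g (circlepath 0 r t) / circlepath 0 r t ^ Suc n
        * vector_derivative (circlepath 0 r) (at t within {0..1})
      = 2 * pi * \<i> / of_real r ^ n * (g (of_real r * E t) / E t ^ n)"
      unfolding v c using \<open>0 < r\<close> by (simp add: E_def power_mult_distrib)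
  qed
  from has_integral_mult_right[OF this, of "of_real r ^ n / (2 * pi * \<i>)"] show ?thesis
    using \<open>0 < r\<close> by (simp add: fps_expansion_def E_def field_simps)
qed

text \<open>With E running over the unit circle, the mean of g/E^n is the coefficient times r^n, and
  the mean of g E^n is zero. Adding the conjugate of the latter replaces g by 2 Re g, which is
  nonnegative and has mean 2 Re g(0). Then r tends to 1.\<close>

lemma caratheodory_coeff_bound:
  assumes hol: "g holomorphic_on \<bbbD>" and Re: "\<And>z. z \<in> \<bbbD> \<Longrightarrow> 0 \<le> Re (g z)" and n: "n \<ge> 1"
  shows "norm (fps_nth (fps_expansion g 0) n) \<le> 2 * Re (g 0)"
proof -
  define E :: "real \<Rightarrow> complex" where "E t = exp (2 * of_real pi * \<i> * of_real t)" for t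
  define G where "G = fps_nth (fps_expansion g 0) n"
  have nE: "norm (E t) = 1" for t
    unfolding E_def by simp
  have E0: "E t \<noteq> 0" for t by (simp add: E_def)
  have cE: "cnj (E t) = 1 / E t" for t
    using complex_norm_square[of "E t"] E0[of t] by (simp add: nE eq_divide_eq mult.commute)
  have main: "norm G * r ^ n \<le> 2 * Re (g 0)" if r: "0 < r" "r < 1" for r
  proof -
    have mem: "of_real r * E t \<in> \<bbbD>" for t using r by (simp add: norm_mult nE)
    have 1: "((\<lambda>t. g (of_real r * E t) / E t ^ n) has_integral G * of_real r ^ n) {0..1}"
      using circle_mean_coeff[OF hol r] by (simp add: E_def G_def)
    \<comment> \<open>The mean value property for g(u) u^n, whose value at 0 vanishes because n
      \<ge> 1.\<close>
    have "(\<lambda>u. g u * u ^ n) holomorphic_on \<bbbD>"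
      by (intro holomorphic_intros hol)
    from circle_mean_coeff[OF this r, of 0]
    have "((\<lambda>t. of_real r ^ n * (g (of_real r * E t) * E t ^ n)) has_integral 0) {0..1}"
      using n by (simp add: E_def fps_expansion_def power_mult_distrib mult_ac power_0_left)
    from has_integral_mult_right[OF this, of "1 / of_real r ^ n"]
    have "((\<lambda>t. g (of_real r * E t) * E t ^ n) has_integral 0) {0..1}"
      using r by simp
    then have "((\<lambda>t. cnj (g (of_real r * E t) * E t ^ n)) has_integral 0) {0..1}"
      using has_integral_cnj[of "\<lambda>t. g (of_real r * E t) * E t ^ n" 0] by (simp only: o_def complex_cnj_zero)
    then have 2: "((\<lambda>t. cnj (g (of_real r * E t)) / E t ^ n) has_integral 0) {0..1}"
      by (simp add: cE power_one_over)
    have 3: "((\<lambda>t. of_real (2 * Re (g (of_real r * E t))) / E t ^ n) has_integral G * of_real r ^ n) {0..1}"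
      using has_integral_add[OF 1 2] by (simp add: complex_add_cnj flip: add_divide_distrib)
    have "((\<lambda>t. g (of_real r * E t)) has_integral g 0) {0..1}"
      using circle_mean_coeff[OF hol r, of 0] by (simp add: E_def fps_expansion_def)
    then have "((\<lambda>t. Re (g (of_real r * E t))) has_integral Re (g 0)) {0..1}"
      by (rule has_integral_Re)
    then have 4: "((\<lambda>t. 2 * Re (g (of_real r * E t))) has_integral 2 * Re (g 0)) {0..1}"
      by (rule has_integral_mult_right)
    have "norm (G * of_real r ^ n) \<le> 2 * Re (g 0)"
      using integral_norm_bound_integral[OF has_integral_integrable[OF 3] has_integral_integrable[OF 4]]
        integral_unique[OF 3] integral_unique[OF 4] Re[OF mem]
      by (auto simp: norm_divide norm_power nE)
    then show ?thesis using r by (simp add: norm_mult norm_power)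
  qed
  have "((\<lambda>r. norm G * r ^ n) \<longlongrightarrow> norm G * 1 ^ n) (at_left 1)"
    by (intro tendsto_intros)
  moreover have "\<forall>\<^sub>F r::real in at_left 1. norm G * r ^ n \<le> 2 * Re (g 0)"
    by (rule eventually_at_leftI[of 0]) (use main in auto)
  ultimately have "norm G * 1 ^ n \<le> 2 * Re (g 0)"
    by (rule tendsto_upperbound) simp
  then show ?thesis by (simp add: G_def)
qed

text \<open>For unimodular c the function 1 - c h has nonnegative real part. Choosing c to rotate
  \<open>h 0\<close> onto the nonnegative axis makes its value at 0 equal to 1 - |h(0)|, and the
  previous bound applies.\<close>

lemma bounded_coeff_bound:
  assumes hol: "h holomorphic_on \<bbbD>" and bd: "\<And>z. z \<in> \<bbbD> \<Longrightarrow> norm (h z) \<le> 1" and n: "n \<ge> 1"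
  shows "norm (fps_nth (fps_expansion h 0) n) \<le> 2 * (1 - norm (h 0))"
proof -
  obtain c where c: "norm c = 1" "c * h 0 = of_real (norm (h 0))"
  proof (cases "h 0 = 0")
    case True
    then show ?thesis using that[of 1] by simp
  next
    case False
    then show ?thesis
      by (intro that[of "of_real (norm (h 0)) / h 0"]) (auto simp: norm_divide)
  qed
  have E: "(\<lambda>z. 1 - c * h z) has_fps_expansion 1 - fps_const c * fps_expansion h 0"
    using hol by (intro fps_expansion_intros has_fps_expansion_fps_expansion[of \<bbbD>]) auto
  moreover have hol': "(\<lambda>z. 1 - c * h z) holomorphic_on \<bbbD>"
    by (intro holomorphic_intros hol)
  then have "(\<lambda>z. 1 - c * h z) has_fps_expansion fps_expansion (\<lambda>z. 1 - c * h z) 0"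
    by (intro has_fps_expansion_fps_expansion[of \<bbbD>]) auto
  ultimately have eq: "fps_expansion (\<lambda>z. 1 - c * h z) 0 = 1 - fps_const c * fps_expansion h 0"
    using fps_expansion_unique_complex by blast
  have "0 \<le> Re (1 - c * h z)" if "z \<in> \<bbbD>" for z
    using bd[OF that] complex_Re_le_cmod[of "c * h z"] by (simp add: norm_mult c)
  from caratheodory_coeff_bound[OF hol' this n]
  show ?thesis using n c by (simp add: eq norm_mult)
qed

text \<open>By the Schwarz lemma \<omega>(z) = z h(z) with |h| \<le> 1. The coefficients of h after
  the first are at most 2(1 - |h(0)|), and the powers of 1/3 from the first on sum to 1/2, so the
  majorant of h is at most 1. This is where the radius 1/3 comes from.\<close>

lemma schwarz_majorant_le:
  assumes hol: "\<omega> holomorphic_on \<bbbD>" and im: "\<omega> ` \<bbbD> \<subseteq> \<bbbD>" and 0: "\<omega> 0 = 0"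
    and r: "0 \<le> r" "r \<le> 1/3"
  shows "(\<Sum>m\<le>N. norm (fps_nth (fps_expansion \<omega> 0) m) * r ^ m) \<le> r"
proof -
  obtain h where h: "h holomorphic_on \<bbbD>" "\<And>z. norm z < 1 \<Longrightarrow> \<omega> z = z * h z" "deriv \<omega> 0 = h 0"
    using Schwarz3[OF hol 0] by blast
  have no: "norm (\<omega> z) < 1" if "norm z < 1" for z using im that by (auto simp: subset_iff)
  have bd: "norm (h z) \<le> 1" if "z \<in> \<bbbD>" for z
  proof (cases "z = 0")
    case True
    then show ?thesis using Schwarz_Lemma(2)[OF hol 0 no, of 0] that h(3) by auto
  next
    case False
    then show ?thesis
      using Schwarz_Lemma(1)[OF hol 0 no, of z] that h(2)[of z] by (auto simp: norm_mult)
  qed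
  define H where "H = fps_expansion h 0"
  have "(\<lambda>z. z * h z) has_fps_expansion fps_X * H"
    unfolding H_def using h(1)
    by (intro fps_expansion_intros has_fps_expansion_fps_expansion[of \<bbbD>]) auto
  moreover have "\<omega> has_fps_expansion fps_expansion \<omega> 0"
    using hol by (intro has_fps_expansion_fps_expansion[of \<bbbD>]) auto
  then have "(\<lambda>z. z * h z) has_fps_expansion fps_expansion \<omega> 0"
    by (rule has_fps_expansion_cong[THEN iffD1, rotated 2])
      (auto simp: h(2) intro!: eventually_nhds_in_open[of \<bbbD>, THEN eventually_mono])
  ultimately have eq: "fps_expansion \<omega> 0 = fps_X * H"
    using fps_expansion_unique_complex by blast
  have H0: "norm (fps_nth H 0) = norm (h 0)" by (simp add: H_def fps_expansion_def)
  have Hn: "norm (fps_nth H n) \<le> 2 * (1 - norm (h 0))" if "n \<ge> 1" for n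
    unfolding H_def using bounded_coeff_bound[OF h(1) bd that] .
  have h0: "norm (h 0) \<le> 1" using bd[of 0] by simp
  \<comment> \<open>The subtracted term is the exact tail of the bounding geometric series, which
    makes the induction telescope.\<close>
  have inv: "(\<Sum>m\<le>M. norm (fps_nth H m) * r ^ m) \<le> 1 - (1 - norm (h 0)) / 3 ^ M" for M
  proof (induction M)
    case 0
    then show ?case by (simp add: H0)
  next
    case (Suc M)
    have "norm (fps_nth H (Suc M)) * r ^ Suc M \<le> (2 * (1 - norm (h 0))) * (1/3) ^ Suc M"
      using r h0 by (intro mult_mono Hn power_mono) auto
    also have "\<dots> = (1 - norm (h 0)) / 3 ^ M - (1 - norm (h 0)) / 3 ^ Suc M"
      by (simp add: power_one_over)
    finally show ?case using Suc by (simp only: sum.atMost_Suc)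
  qed
  have M1: "(\<Sum>m\<le>M. norm (fps_nth H m) * r ^ m) \<le> 1" for M
    by (rule order.trans[OF inv]) (use h0 in simp)
  show ?thesis
  proof (cases N)
    case 0
    then show ?thesis using r by (simp add: eq)
  next
    case (Suc M)
    have "(\<Sum>m\<le>N. norm (fps_nth (fps_expansion \<omega> 0) m) * r ^ m)
        = r * (\<Sum>m\<le>M. norm (fps_nth H m) * r ^ m)"
      unfolding Suc sum.atMost_Suc_shift by (simp add: eq sum_distrib_left mult_ac)
    also have "\<dots> \<le> r * 1" using M1 r by (intro mult_left_mono) auto
    finally show ?thesis by simp
  qed
qed

section \<open>Majorants of power series\<close>

text \<open>The Cauchy product runs over the triangle i + j \<le> N, which lies in the square of
  pairs with both indices at most N, and all terms are nonnegative. Truncated sums keep convergence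
  out of the argument.\<close>

lemma fps_mult_majorant:
  fixes F G :: "'a::{real_normed_algebra_1,comm_ring_1} fps"
  assumes "0 \<le> (r::real)"
  shows "(\<Sum>m\<le>N. norm (fps_nth (F * G) m) * r ^ m)
    \<le> (\<Sum>m\<le>N. norm (fps_nth F m) * r ^ m) * (\<Sum>m\<le>N. norm (fps_nth G m) * r ^ m)"
proof -
  let ?f = "\<lambda>m. norm (fps_nth F m) * r ^ m" and ?g = "\<lambda>m. norm (fps_nth G m) * r ^ m"
  have "(\<Sum>m\<le>N. norm (fps_nth (F * G) m) * r ^ m) \<le> (\<Sum>m\<le>N. \<Sum>i\<le>m. ?f i * ?g (m - i))"
  proof (rule sum_mono)
    fix m
    have "norm (fps_nth (F * G) m) * r ^ m
        \<le> (\<Sum>i\<le>m. norm (fps_nth F i) * norm (fps_nth G (m - i))) * r ^ m"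
      unfolding fps_mult_nth atLeast0AtMost using assms
      by (intro mult_right_mono order.trans[OF norm_sum] sum_mono norm_mult_ineq) auto
    also have "\<dots> = (\<Sum>i\<le>m. ?f i * ?g (m - i))"
      unfolding sum_distrib_right
    proof (rule sum.cong)
      fix i assume "i \<in> {..m}"
      then have "r ^ m = r ^ i * r ^ (m - i)" by (simp flip: power_add)
      then show "norm (fps_nth F i) * norm (fps_nth G (m - i)) * r ^ m = ?f i * ?g (m - i)"
        by simp
    qed simp
    finally show "norm (fps_nth (F * G) m) * r ^ m \<le> (\<Sum>i\<le>m. ?f i * ?g (m - i))" .
  qed
  also have "\<dots> = (\<Sum>(i, j)\<in>{(i, j). i + j \<le> N}. ?f i * ?g j)"
    by (rule sum.triangle_reindex_eq[symmetric])
  also have "\<dots> \<le> (\<Sum>(i, j)\<in>{..N} \<times> {..N}. ?f i * ?g j)"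
    using assms by (intro sum_mono2) auto
  also have "\<dots> = (\<Sum>m\<le>N. ?f m) * (\<Sum>m\<le>N. ?g m)"
    by (simp add: sum_product sum.cartesian_product)
  finally show ?thesis .
qed

lemma fps_power_majorant:
  fixes F :: "'a::{real_normed_algebra_1,comm_ring_1} fps"
  assumes "0 \<le> (r::real)"
  shows "(\<Sum>m\<le>N. norm (fps_nth (F ^ i) m) * r ^ m) \<le> (\<Sum>m\<le>N. norm (fps_nth F m) * r ^ m) ^ i"
proof (induction i)
  case 0
  have "(\<Sum>m\<le>N. norm (fps_nth (1 :: 'a fps) m) * r ^ m) = (\<Sum>m\<le>N. if m = 0 then 1 else 0)"
    by (intro sum.cong) auto
  then show ?case by simp
next
  case (Suc i)
  have "(\<Sum>m\<le>N. norm (fps_nth (F ^ Suc i) m) * r ^ m)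
    \<le> (\<Sum>m\<le>N. norm (fps_nth F m) * r ^ m) * (\<Sum>m\<le>N. norm (fps_nth (F ^ i) m) * r ^ m)"
    unfolding power_Suc by (rule fps_mult_majorant[OF assms])
  also have "\<dots> \<le> (\<Sum>m\<le>N. norm (fps_nth F m) * r ^ m) * (\<Sum>m\<le>N. norm (fps_nth F m) * r ^ m) ^ i"
    using Suc assms by (intro mult_left_mono sum_nonneg) auto
  finally show ?case by simp
qed

text \<open>Coefficient m of the composition involves only the powers \<open>F ^ i\<close> with i
  \<le> m. Extending the range to i \<le> N and swapping the sums leaves the majorants of the powers
  of F, each at most \<open>s ^ i\<close>.\<close>

lemma fps_compose_majorant:
  fixes A F :: "'a::{real_normed_algebra_1,comm_ring_1} fps"
  assumes r: "0 \<le> (r::real)" and F: "(\<Sum>m\<le>N. norm (fps_nth F m) * r ^ m) \<le> s"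
  shows "(\<Sum>m\<le>N. norm (fps_nth (A oo F) m) * r ^ m) \<le> (\<Sum>i\<le>N. norm (fps_nth A i) * s ^ i)"
proof -
  have "(\<Sum>m\<le>N. norm (fps_nth (A oo F) m) * r ^ m)
      \<le> (\<Sum>m\<le>N. \<Sum>i\<le>N. norm (fps_nth A i) * (norm (fps_nth (F ^ i) m) * r ^ m))"
  proof (rule sum_mono)
    fix m assume m: "m \<in> {..N}"
    have "norm (fps_nth (A oo F) m) * r ^ m
        \<le> (\<Sum>i\<le>m. norm (fps_nth A i) * norm (fps_nth (F ^ i) m)) * r ^ m"
      unfolding fps_compose_nth atLeast0AtMost using r
      by (intro mult_right_mono order.trans[OF norm_sum] sum_mono norm_mult_ineq) auto
    also have "\<dots> = (\<Sum>i\<le>m. norm (fps_nth A i) * (norm (fps_nth (F ^ i) m) * r ^ m))"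
      by (simp add: sum_distrib_right mult.assoc)
    also have "\<dots> \<le> (\<Sum>i\<le>N. norm (fps_nth A i) * (norm (fps_nth (F ^ i) m) * r ^ m))"
      using m r by (intro sum_mono2) auto
    finally show "norm (fps_nth (A oo F) m) * r ^ m
        \<le> (\<Sum>i\<le>N. norm (fps_nth A i) * (norm (fps_nth (F ^ i) m) * r ^ m))" .
  qed
  also have "\<dots> = (\<Sum>i\<le>N. norm (fps_nth A i) * (\<Sum>m\<le>N. norm (fps_nth (F ^ i) m) * r ^ m))"
    unfolding sum_distrib_left by (rule sum.swap)
  also have "\<dots> \<le> (\<Sum>i\<le>N. norm (fps_nth A i) * s ^ i)"
    using r F by (intro sum_mono mult_left_mono order.trans[OF fps_power_majorant] power_mono sum_nonneg) auto
  finally show ?thesis .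
qed

lemma DERIV_power_sum:
  fixes c :: "nat \<Rightarrow> real"
  shows "((\<lambda>t. \<Sum>n\<le>N. c n * t ^ n) has_real_derivative (\<Sum>n\<le>N. c n * (real n * s ^ (n - 1)))) (at s)"
  unfolding One_nat_def by (intro DERIV_sum DERIV_cmult DERIV_pow)

text \<open>A Gronwall comparison: the truncated majorant V of U is a polynomial with s V'(s) \<le>
  q(s) V(s), while s \<kappa>'(s) = q(s) \<kappa>(s). Hence V/\<kappa> is nonincreasing and starts
  at most at 1. The derivative of \<kappa> is asked for only at positive points because of the
  division by t.\<close>

lemma fps_logarithmic_derivative_majorant:
  fixes P U :: "complex fps" and q \<kappa> :: "real \<Rightarrow> real"
  assumes eq: "fps_X * fps_deriv U = P * U"
    and P: "\<And>t. 0 < t \<Longrightarrow> t < R \<Longrightarrow> (\<Sum>j\<le>N. norm (fps_nth P j) * t ^ j) \<le> q t"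
    and cont: "continuous_on {0..R} \<kappa>"
    and der: "\<And>t. 0 < t \<Longrightarrow> t < R \<Longrightarrow> (\<kappa> has_real_derivative q t * \<kappa> t / t) (at t)"
    and pos: "\<And>t. 0 \<le> t \<Longrightarrow> t \<le> R \<Longrightarrow> \<kappa> t > 0"
    and U0: "norm (fps_nth U 0) \<le> \<kappa> 0"
    and t: "0 \<le> t" "t \<le> R"
  shows "(\<Sum>n\<le>N. norm (fps_nth U n) * t ^ n) \<le> \<kappa> t"
proof -
  define V where "V t = (\<Sum>n\<le>N. norm (fps_nth U n) * t ^ n)" for t :: real
  define V' where "V' t = (\<Sum>n\<le>N. norm (fps_nth U n) * (real n * t ^ (n - 1)))" for t :: real
  have V': "(V has_real_derivative V' s) (at s)" for s
    unfolding V_def V'_def by (rule DERIV_power_sum)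
  have V0: "V 0 = norm (fps_nth U 0)"
    unfolding V_def by (simp add: power_0_left if_distrib sum.delta cong: if_cong)
  \<comment> \<open>The formal equation identifies the coefficients of s V'(s) with those of the
    majorant of the product.\<close>
  have nth: "norm (fps_nth (P * U) n) = real n * norm (fps_nth U n)" for n
  proof -
    have "fps_nth (fps_X * fps_deriv U) n = of_nat n * fps_nth U n"
      by (cases n) auto
    then show ?thesis by (metis eq norm_mult norm_of_nat)
  qed
  have le: "s * V' s \<le> q s * V s" if s: "0 < s" "s < R" for s
  proof -
    have "s * V' s = (\<Sum>n\<le>N. norm (fps_nth (P * U) n) * s ^ n)"
      unfolding V'_def sum_distrib_left
    proof (rule sum.cong)
      fix n
      show "s * (norm (fps_nth U n) * (real n * s ^ (n - 1))) = norm (fps_nth (P * U) n) * s ^ n"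
        unfolding nth by (cases n) auto
    qed simp
    also have "\<dots> \<le> (\<Sum>n\<le>N. norm (fps_nth P n) * s ^ n) * V s"
      unfolding V_def by (rule fps_mult_majorant) (use s in simp)
    also have "\<dots> \<le> q s * V s"
      using P[OF s] s unfolding V_def by (intro mult_right_mono sum_nonneg) auto
    finally show ?thesis .
  qed
  have "V t / \<kappa> t \<le> V 0 / \<kappa> 0"
  proof (rule DERIV_nonpos_imp_decreasing_open[OF t(1)])
    fix s assume "0 < s" "s < t"
    then have s: "0 < s" "s < R" using t by auto
    have k: "\<kappa> s > 0" using pos s by simp
    have "((\<lambda>s. V s / \<kappa> s) has_real_derivative
        (V' s * \<kappa> s - V s * (q s * \<kappa> s / s)) / (\<kappa> s * \<kappa> s)) (at s)"
      using DERIV_divide[OF V' der[OF s]] k by simp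
    moreover have "V' s * \<kappa> s - V s * (q s * \<kappa> s / s) = (s * V' s - q s * V s) * \<kappa> s / s"
      using s by (simp add: field_simps)
    then have "V' s * \<kappa> s - V s * (q s * \<kappa> s / s) \<le> 0"
      using le[OF s] k s by (simp add: divide_le_0_iff mult_le_0_iff)
    then have "(V' s * \<kappa> s - V s * (q s * \<kappa> s / s)) / (\<kappa> s * \<kappa> s) \<le> 0"
      using k by (simp add: divide_le_0_iff)
    ultimately show "\<exists>y. ((\<lambda>s. V s / \<kappa> s) has_real_derivative y) (at s) \<and> y \<le> 0"
      by blast
  next
    have "continuous_on {0..t} V"
      using V' by (meson DERIV_continuous_on has_field_derivative_at_within)
    moreover have "continuous_on {0..t} \<kappa>"
      by (rule continuous_on_subset[OF cont]) (use t in auto)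
    ultimately show "continuous_on {0..t} (\<lambda>s. V s / \<kappa> s)"
      by (intro continuous_on_divide) (use pos t in \<open>force+\<close>)
  qed
  also have "\<dots> \<le> 1" using U0 pos[of 0] t by (simp add: V0)
  finally show ?thesis using pos[OF t] by (simp add: V_def)
qed

text \<open>Differentiating the majorant of F truncated at \<open>Suc N\<close> gives the majorant
  of F' truncated at \<open>N\<close>. So the difference of k and the former is nondecreasing from a
  nonnegative value.\<close>

lemma fps_antiderivative_majorant:
  fixes F :: "complex fps" and k \<kappa> :: "real \<Rightarrow> real"
  assumes maj: "\<And>t. 0 < t \<Longrightarrow> t < R \<Longrightarrow> (\<Sum>n\<le>N. norm (fps_nth (fps_deriv F) n) * t ^ n) \<le> \<kappa> t"
    and der: "\<And>t. 0 \<le> t \<Longrightarrow> t \<le> R \<Longrightarrow> (k has_real_derivative \<kappa> t) (at t)"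
    and F0: "norm (fps_nth F 0) \<le> k 0"
    and t: "0 \<le> t" "t \<le> R"
  shows "(\<Sum>n\<le>Suc N. norm (fps_nth F n) * t ^ n) \<le> k t"
proof -
  define V where "V t = (\<Sum>n\<le>Suc N. norm (fps_nth F n) * t ^ n)" for t :: real
  have V: "(V has_real_derivative (\<Sum>n\<le>N. norm (fps_nth (fps_deriv F) n) * s ^ n)) (at s)" for s
  proof -
    have "(V has_real_derivative (\<Sum>n\<le>Suc N. norm (fps_nth F n) * (real n * s ^ (n - 1)))) (at s)"
      unfolding V_def by (rule DERIV_power_sum)
    also have "(\<Sum>n\<le>Suc N. norm (fps_nth F n) * (real n * s ^ (n - 1)))
        = (\<Sum>n\<le>N. norm (fps_nth (fps_deriv F) n) * s ^ n)"
      unfolding sum.atMost_Suc_shift by (simp add: norm_mult mult_ac del: of_nat_Suc)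
    finally show ?thesis .
  qed
  have V0: "V 0 = norm (fps_nth F 0)"
    unfolding V_def sum.atMost_Suc_shift by simp
  have "k 0 - V 0 \<le> k t - V t"
  proof (rule DERIV_nonneg_imp_increasing_open[OF t(1)])
    fix s assume s: "0 < s" "s < t"
    have "((\<lambda>s. k s - V s) has_real_derivative
        \<kappa> s - (\<Sum>n\<le>N. norm (fps_nth (fps_deriv F) n) * s ^ n)) (at s)"
      by (intro DERIV_diff V der) (use s t in auto)
    then show "\<exists>y. ((\<lambda>s. k s - V s) has_real_derivative y) (at s) \<and> 0 \<le> y"
      using maj[of s] s t by force
  next
    show "continuous_on {0..t} (\<lambda>s. k s - V s)"
      by (rule continuous_at_imp_continuous_on)
        (use t in \<open>auto intro!: continuous_diff DERIV_isCont[OF der] DERIV_isCont[OF V]\<close>)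
  qed
  then show ?thesis using F0 V0 by (simp add: V_def)
qed

text \<open>Since P has no constant term, comparing coefficients expresses n times the n-th
  coefficient of U through products of coefficients of P with earlier ones of U. Strong induction
  does the rest.\<close>

lemma fps_logarithmic_derivative_nonneg:
  fixes P U :: "complex fps"
  assumes eq: "fps_X * fps_deriv U = P * U"
    and P: "\<And>n. fps_nth P n \<in> \<real>" "\<And>n. 0 \<le> Re (fps_nth P n)" and P0: "fps_nth P 0 = 0"
    and U0: "fps_nth U 0 = 1"
  shows "fps_nth U n \<in> \<real> \<and> 0 \<le> Re (fps_nth U n)"
proof (induction n rule: less_induct)
  case (less n)
  show ?case
  proof (cases n)
    case 0
    then show ?thesis using U0 by simp
  next
    case (Suc m)
    have "of_nat n * fps_nth U n = fps_nth (fps_X * fps_deriv U) n"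
      by (simp add: Suc)
    also have "\<dots> = (\<Sum>i\<le>m. fps_nth P (Suc i) * fps_nth U (m - i))"
      unfolding eq fps_mult_nth Suc atLeast0AtMost sum.atMost_Suc_shift by (simp add: P0)
    finally have U: "fps_nth U n = (\<Sum>i\<le>m. fps_nth P (Suc i) * fps_nth U (m - i)) / of_nat n"
      using Suc by (metis of_nat_eq_0_iff nonzero_mult_div_cancel_left nat.distinct(1))
    have IH: "fps_nth U (m - i) \<in> \<real>" "0 \<le> Re (fps_nth U (m - i))" for i
      using less[of "m - i"] Suc by auto
    have "0 \<le> Re (fps_nth P (Suc i) * fps_nth U (m - i))" for i
      using P IH[of i] by (auto simp: complex_is_Real_iff)
    then have "0 \<le> Re (fps_nth U n)"
      unfolding U by (auto intro!: sum_nonneg divide_nonneg_nonneg simp: Re_divide_of_nat)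
    moreover have "fps_nth U n \<in> \<real>"
      unfolding U using P IH by (intro Reals_divide sum_in_Reals Reals_mult) auto
    ultimately show ?thesis by blast
  qed
qed

section \<open>Holomorphic functions with real coefficients\<close>

lemma Re_along_curve_has_derivative:
  assumes f: "f holomorphic_on S" "open S" "\<gamma> t \<in> S"
    and \<gamma>: "(\<gamma> has_vector_derivative \<gamma>') (at t)"
  shows "((\<lambda>t. Re (f (\<gamma> t))) has_real_derivative Re (\<gamma>' * deriv f (\<gamma> t))) (at t)"
proof -
  have "((f \<circ> \<gamma>) has_vector_derivative \<gamma>' * deriv f (\<gamma> t)) (at t)"
    by (intro field_vector_diff_chain_at \<gamma> holomorphic_derivI[OF f])
  then show ?thesis
    by (auto simp: has_vector_derivative_complex_iff o_def)
qed

lemma Re_on_reals_has_derivative: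
  assumes "f holomorphic_on \<bbbD>" "\<bar>t\<bar> < 1"
  shows "((\<lambda>t. Re (f (of_real t))) has_real_derivative Re (deriv f (of_real t))) (at t)"
proof -
  have "(complex_of_real has_vector_derivative 1) (at t)"
    by (rule has_vector_derivative_real_field) (rule DERIV_ident)
  then show ?thesis
    using Re_along_curve_has_derivative[OF assms(1), of of_real t 1] assms(2) by simp
qed

lemma disc_power_series:
  assumes "f holomorphic_on \<bbbD>" "z \<in> \<bbbD>"
  shows "(\<lambda>n. fps_nth (fps_expansion f 0) n * z ^ n) sums f z"
  using holomorphic_power_series[OF assms] by (simp add: fps_expansion_def)

lemma cnj_of_real_coeffs:
  assumes f: "f holomorphic_on \<bbbD>" and re: "\<And>n. fps_nth (fps_expansion f 0) n \<in> \<real>"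
    and z: "z \<in> \<bbbD>"
  shows "f (cnj z) = cnj (f z)"
proof -
  have "(\<lambda>n. fps_nth (fps_expansion f 0) n * cnj z ^ n) sums cnj (f z)"
    using disc_power_series[OF f z] re by (subst sums_cnj[symmetric]) (simp add: Reals_cnj_iff)
  moreover have "(\<lambda>n. fps_nth (fps_expansion f 0) n * cnj z ^ n) sums f (cnj z)"
    using z by (intro disc_power_series f) auto
  ultimately show ?thesis using sums_unique2 by blast
qed

lemma real_on_reals:
  assumes "f holomorphic_on \<bbbD>" "\<And>n. fps_nth (fps_expansion f 0) n \<in> \<real>" "\<bar>t\<bar> < 1"
  shows "f (of_real t) \<in> \<real>"
  using cnj_of_real_coeffs[OF assms(1,2), of "of_real t"] assms(3) by (simp add: Reals_cnj_iff)

text \<open>On (-1,1) the function is real and has no zero, so by connectedness it keeps the sign it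
  has at 0.\<close>

lemma positive_on_reals:
  assumes f: "f holomorphic_on \<bbbD>" and re: "\<And>n. fps_nth (fps_expansion f 0) n \<in> \<real>"
    and nz: "\<And>z. z \<in> \<bbbD> \<Longrightarrow> f z \<noteq> 0" and pos: "Re (f 0) > 0" and t: "\<bar>t\<bar> < 1"
  shows "Re (f (of_real t)) > 0"
proof (rule ccontr)
  assume neg: "\<not> Re (f (of_real t)) > 0"
  define g where "g s = Re (f (of_real s))" for s :: real
  have "continuous_on {-1<..<1} g"
    unfolding g_def
    by (intro continuous_at_imp_continuous_on ballI DERIV_isCont[OF Re_on_reals_has_derivative[OF f]]) auto
  then have "connected (g ` {-1<..<1})"
    by (intro connected_continuous_image) auto
  moreover have "g t \<in> g ` {-1<..<1}" "g 0 \<in> g ` {-1<..<1}" using t by (auto intro!: imageI)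
  ultimately have "0 \<in> g ` {-1<..<1}"
    using neg pos unfolding connected_iff_interval g_def by (metis less_eq_real_def not_le of_real_0)
  then obtain s where s: "\<bar>s\<bar> < 1" "Re (f (of_real s)) = 0" by (auto simp: g_def abs_less_iff)
  then have "f (of_real s) = 0"
    using real_on_reals[OF f re s(1)] by (simp add: complex_eq_iff complex_is_Real_iff)
  then show False using nz[of "of_real s"] s by simp
qed

lemma fps_expansion_deriv: "fps_expansion (deriv f) z = fps_deriv (fps_expansion f z)"
proof (rule fps_ext)
  fix n
  have "(deriv ^^ Suc n) f = (deriv ^^ n) (deriv f)"
    by (simp only: funpow_Suc_right o_apply)
  then show "fps_nth (fps_expansion (deriv f) z) n = fps_nth (fps_deriv (fps_expansion f z)) n"
    by (simp add: fps_expansion_def del: of_nat_Suc funpow.simps)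
qed

lemma schwarz_norm_le:
  assumes "\<omega> holomorphic_on \<bbbD>" "\<omega> ` \<bbbD> \<subseteq> \<bbbD>" "\<omega> 0 = 0" "z \<in> \<bbbD>"
  shows "norm (\<omega> z) \<le> norm z"
  using assms by (intro Schwarz_Lemma(1)) (auto simp: subset_iff)

text \<open>Real coefficients supply the symmetry pointwise, as
  \<open>\<phi> (cnj z) = cnj (\<phi> z)\<close>. Together with injectivity this shows that real
  values are taken only on the real axis.\<close>

locale real_univalent =
  fixes \<phi> :: "complex \<Rightarrow> complex"
  assumes hol: "\<phi> holomorphic_on \<bbbD>"
    and inj: "inj_on \<phi> \<bbbD>"
    and coeffs_real: "\<And>n. fps_nth (fps_expansion \<phi> 0) n \<in> \<real>"
    and deriv_pos: "Re (deriv \<phi> 0) > 0"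
begin

lemma deriv_nonzero: "z \<in> \<bbbD> \<Longrightarrow> deriv \<phi> z \<noteq> 0"
  using holomorphic_injective_imp_regular[OF hol _ inj] by auto

lemma deriv_pos_on_reals:
  assumes "\<bar>t\<bar> < 1"
  shows "Re (deriv \<phi> (of_real t)) > 0"
proof (rule positive_on_reals)
  show "deriv \<phi> holomorphic_on \<bbbD>" by (intro holomorphic_deriv hol) auto
  show "fps_nth (fps_expansion (deriv \<phi>) 0) n \<in> \<real>" for n
    unfolding fps_expansion_deriv using coeffs_real by simp
qed (use assms deriv_nonzero deriv_pos in auto)

lemma mono_on_reals:
  assumes "-1 < s" "s \<le> t" "t < 1"
  shows "Re (\<phi> (of_real s)) \<le> Re (\<phi> (of_real t))"
proof (rule DERIV_nonneg_imp_nondecreasing[OF assms(2)])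
  fix x assume "s \<le> x" "x \<le> t"
  then have "\<bar>x\<bar> < 1" using assms by auto
  then show "\<exists>y. ((\<lambda>x. Re (\<phi> (of_real x))) has_real_derivative y) (at x) \<and> 0 \<le> y"
    using Re_on_reals_has_derivative[OF hol] deriv_pos_on_reals by (meson less_imp_le)
qed

lemma real_value_imp_real:
  assumes "z \<in> \<bbbD>" "\<phi> z \<in> \<real>"
  shows "z \<in> \<real>"
proof -
  have "\<phi> (cnj z) = \<phi> z"
    using cnj_of_real_coeffs[OF hol coeffs_real assms(1)] assms(2) by (simp add: Reals_cnj_iff)
  then have "cnj z = z"
    using inj assms(1) by (auto dest!: inj_onD)
  then show ?thesis by (simp add: Reals_cnj_iff)
qed

text \<open>
  At a minimum of \<open>Re (L z) - H \<bar>z\<bar> + \<epsilon> \<bar>z\<bar>\<close> the angular derivative of \<open>Re L\<close> vanishes, so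
  \<open>z L'(z)\<close> is a real value of \<open>\<phi> - \<phi>(0)\<close>. By injectivity and symmetry it is attained at a real point, hence
  is at least \<open>\<phi>(-\<bar>z\<bar>) - \<phi>(0)\<close>, and the radial derivative is positive there: a contradiction.
\<close>

lemma Re_integral_subordinate_ge:
  assumes L: "L holomorphic_on \<bbbD>" "L 0 = 0"
    and \<omega>: "\<omega> holomorphic_on \<bbbD>" "\<omega> ` \<bbbD> \<subseteq> \<bbbD>" "\<omega> 0 = 0"
    and L': "\<And>z. z \<in> \<bbbD> \<Longrightarrow> z * deriv L z = \<phi> (\<omega> z) - \<phi> 0"
    and H0: "H 0 = 0" and H_cont: "continuous_on {0..<1} H"
    and H': "\<And>r. 0 < r \<Longrightarrow> r < 1 \<Longrightarrow>
      (H has_real_derivative (Re (\<phi> (of_real (- r))) - Re (\<phi> 0)) / r) (at r)"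
    and z: "z \<in> \<bbbD>"
  shows "H (norm z) \<le> Re (L z)"
proof (rule ccontr)
  assume neg: "\<not> H (norm z) \<le> Re (L z)"
  define R where "R = norm z"
  have "z \<noteq> 0" using neg L(2) H0 by auto
  then have R: "0 < R" "R < 1" using z by (auto simp: R_def)
  \<comment> \<open>Half the assumed defect, spread over the radius R: the penalty leaves
    \<open>F z\<close> negative, yet adds a strictly positive amount to the radial
    derivative.\<close>
  define \<epsilon> where "\<epsilon> = (H R - Re (L z)) / (2 * R)"
  have \<epsilon>: "\<epsilon> > 0" using neg R by (simp add: \<epsilon>_def R_def)
  define F where "F w = Re (L w) - H (norm w) + \<epsilon> * norm w" for w
  have "F z = (Re (L z) - H R) / 2"
    using R by (simp add: F_def \<epsilon>_def field_simps flip: R_def)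
  then have Fz: "F z < 0"
    using neg by (simp add: R_def)
  have "continuous_on (cball 0 R) F"
    unfolding F_def
    by (intro continuous_intros continuous_on_compose2[OF H_cont]
          continuous_on_subset[OF holomorphic_on_imp_continuous_on[OF L(1)]]) (use R in auto)
  then obtain w where w: "w \<in> cball 0 R" "\<And>v. v \<in> cball 0 R \<Longrightarrow> F w \<le> F v"
    using continuous_attains_inf[of "cball 0 R" F] R by auto
  \<comment> \<open>The minimum is below \<open>F 0 = 0\<close>, so the minimiser is not the origin
    and polar directions exist there.\<close>
  have "F w < 0" using w(2)[of z] Fz by (auto simp: R_def)
  moreover have "F 0 = 0" by (simp add: F_def L H0)
  ultimately have "w \<noteq> 0" by auto
  define r where "r = norm w"
  have r: "0 < r" "r < 1" "r \<le> R" using w(1) R \<open>w \<noteq> 0\<close> by (auto simp: r_def)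
  have wD: "w \<in> \<bbbD>" using r by (simp add: r_def)
  have exp_der: "((\<lambda>\<theta>. w * exp (\<i> * of_real \<theta>)) has_vector_derivative \<i> * w) (at 0)"
    by (rule has_vector_derivative_real_field) (auto intro!: derivative_eq_intros)
  have "((\<lambda>\<theta>. Re (L (w * exp (\<i> * of_real \<theta>)))) has_real_derivative Re (\<i> * w * deriv L w)) (at 0)"
    using Re_along_curve_has_derivative[OF L(1) _ _ exp_der] wD by simp
  \<comment> \<open>The other terms of F depend on the modulus alone and are constant along the
    circle through w.\<close>
  moreover have "Re (L (w * exp (\<i> * of_real 0))) \<le> Re (L (w * exp (\<i> * of_real \<theta>)))" for \<theta>
    using w(2)[of "w * exp (\<i> * of_real \<theta>)"] w(1) by (simp add: F_def norm_mult)
  ultimately have "Re (\<i> * w * deriv L w) = 0"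
    by (intro DERIV_local_min[of _ _ 0 1]) auto
  then have "Im (w * deriv L w) = 0"
    by (simp add: mult.assoc)
  moreover have "\<phi> 0 \<in> \<real>" using real_on_reals[OF hol coeffs_real, of 0] by simp
  ultimately have "\<phi> (\<omega> w) \<in> \<real>"
    using L'[OF wD] by (simp add: complex_is_Real_iff)
  moreover have \<omega>w: "\<omega> w \<in> \<bbbD>" using \<omega>(2) wD by blast
  ultimately obtain x where x: "\<omega> w = of_real x"
    using real_value_imp_real by (auto elim: Reals_cases)
  have "\<bar>x\<bar> \<le> r" using schwarz_norm_le[OF \<omega> wD] by (simp add: x r_def)
  then have ge: "Re (\<phi> (of_real (- r))) \<le> Re (\<phi> (of_real x))"
    using r by (intro mono_on_reals) auto
  have ray_der: "((\<lambda>s. of_real s * w) has_vector_derivative w) (at 1)"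
    by (rule has_vector_derivative_real_field) (auto intro!: derivative_eq_intros)
  have 1: "((\<lambda>s. Re (L (of_real s * w))) has_real_derivative Re (w * deriv L w)) (at 1)"
    using Re_along_curve_has_derivative[OF L(1) _ _ ray_der] wD by simp
  have 2: "((\<lambda>s. H (s * r)) has_real_derivative
      (Re (\<phi> (of_real (- r))) - Re (\<phi> 0)) / r * r) (at 1)"
    by (rule DERIV_chain2[of H]) (use H'[OF r(1,2)] in \<open>auto intro!: derivative_eq_intros\<close>)
  have "((\<lambda>s. Re (L (of_real s * w)) - H (s * r) + \<epsilon> * (s * r)) has_real_derivative
      Re (w * deriv L w) - (Re (\<phi> (of_real (- r))) - Re (\<phi> 0)) / r * r + \<epsilon> * r) (at 1)"
    by (intro DERIV_add DERIV_diff 1 2) (auto intro!: derivative_eq_intros)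
  moreover have "Re (w * deriv L w) - (Re (\<phi> (of_real (- r))) - Re (\<phi> 0)) / r * r + \<epsilon> * r > 0"
    using ge r mult_pos_pos[OF \<epsilon> r(1)] L'[OF wD] by (simp add: x del: mult_pos_pos)
  \<comment> \<open>Only inward motion is used: the points (1 - h) w stay in
    \<open>cball 0 R\<close> even if w lies on its boundary.\<close>
  ultimately obtain d where d: "d > 0"
    "\<And>h. 0 < h \<Longrightarrow> h < d \<Longrightarrow>
      Re (L (of_real (1 - h) * w)) - H ((1 - h) * r) + \<epsilon> * ((1 - h) * r)
      < Re (L (of_real 1 * w)) - H (1 * r) + \<epsilon> * (1 * r)"
    using DERIV_pos_inc_left by blast
  define h where "h = min (d / 2) (1 / 2)"
  have h: "0 < h" "h < d" "h < 1" using d(1) by (auto simp: h_def)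
  have nh: "norm (of_real (1 - h) * w) = (1 - h) * r"
    unfolding norm_mult norm_of_real r_def using h by simp
  have "(1 - h) * r \<le> R" using h r by (smt (verit, best) mult_left_le_one_le)
  then have "F w \<le> F (of_real (1 - h) * w)"
    by (intro w(2)) (simp only: mem_cball dist_0_norm nh)
  then show False
    using d(2)[OF h(1,2)] unfolding F_def nh by (simp add: r_def)
qed

end

section \<open>Distance to the boundary of a univalent image\<close>

text \<open>If the frontier were empty, the image would be the whole plane and the inverse a bounded
  entire function, hence constant by Liouville. Nonemptiness lets the distance to the frontier be
  attained.\<close>

lemma frontier_univalent_image_nonempty:
  assumes hol: "f holomorphic_on \<bbbD>" and inj: "inj_on f \<bbbD>"
  shows "frontier (f ` \<bbbD>) \<noteq> {}"
proof
  assume "frontier (f ` \<bbbD>) = {}"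
  then have U: "f ` \<bbbD> = UNIV" by (simp add: frontier_eq_empty)
  obtain g where g: "g holomorphic_on (f ` \<bbbD>)" "\<And>z. z \<in> \<bbbD> \<Longrightarrow> g (f z) = z"
    using holomorphic_has_inverse[OF hol _ inj] by (metis open_ball)
  have "range g \<subseteq> \<bbbD>"
  proof
    fix y assume "y \<in> range g"
    then obtain w where "y = g w" by auto
    moreover obtain z where "z \<in> \<bbbD>" "w = f z" using U by blast
    ultimately show "y \<in> \<bbbD>" using g(2) by simp
  qed
  then have "bounded (range g)" using bounded_subset bounded_ball by blast
  then obtain c where c: "\<And>w. g w = c"
    using Liouville_theorem[of g] g(1) U by (metis constant_on_def UNIV_I)
  have "g (f 0) = 0" "g (f (1/2)) = 1/2" by (intro g(2); simp)+
  then show False using c by simp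
qed

text \<open>Let w be a nearest boundary point, at distance d, and u its direction. With g inverse to
  f, N(t) = |g(tu)| satisfies N' \<le> |g'| = 1/|f'| \<le> 1/\<kappa>(N), so K(N(t)) \<le> t. As
  N(t) exceeds any given \<rho> < 1 for some t < d, K(\<rho>) \<le> d follows.\<close>

lemma growth_le_infdist_frontier:
  assumes hol: "f holomorphic_on \<bbbD>" and inj: "inj_on f \<bbbD>" and f0: "f 0 = 0"
    and K0: "K 0 = 0" and K_cont: "continuous_on {0..<1} K"
    and K': "\<And>r. 0 < r \<Longrightarrow> r < 1 \<Longrightarrow> (K has_real_derivative \<kappa> r) (at r)"
    and \<kappa>: "\<And>r. 0 < r \<Longrightarrow> r < 1 \<Longrightarrow> 0 < \<kappa> r"
    and f': "\<And>z. z \<in> \<bbbD> \<Longrightarrow> z \<noteq> 0 \<Longrightarrow> \<kappa> (norm z) \<le> norm (deriv f z)"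
    and \<rho>: "0 \<le> \<rho>" "\<rho> < 1"
  shows "K \<rho> \<le> infdist 0 (frontier (f ` \<bbbD>))"
proof -
  define \<Omega> where "\<Omega> = f ` \<bbbD>"
  obtain w where w: "w \<in> frontier \<Omega>" "infdist 0 (frontier \<Omega>) = norm w"
    using infdist_attains_inf[of "frontier \<Omega>" 0] frontier_univalent_image_nonempty[OF hol inj]
    by (auto simp: \<Omega>_def)
  define d where "d = norm w"
  have "open \<Omega>" unfolding \<Omega>_def using open_mapping_thm3[OF hol _ inj] by simp
  have z\<Omega>: "0 \<in> \<Omega>" unfolding \<Omega>_def using f0 by (force intro!: image_eqI[of _ _ 0])
  have w\<Omega>: "w \<notin> \<Omega>" using w(1) \<open>open \<Omega>\<close> by (simp add: frontier_def interior_open)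
  then have d: "d > 0" using z\<Omega> by (auto simp: d_def)
  \<comment> \<open>The ball meets \<Omega> at 0. If it left \<Omega>, connectedness would yield a
    frontier point nearer than w.\<close>
  have ball: "ball 0 d \<subseteq> \<Omega>"
  proof (rule ccontr)
    assume "\<not> ball 0 d \<subseteq> \<Omega>"
    moreover have "0 \<in> ball 0 d \<inter> \<Omega>" using z\<Omega> d by simp
    ultimately have "ball 0 d \<inter> frontier \<Omega> \<noteq> {}"
      by (intro connected_Int_frontier) (simp, blast+)
    then obtain v where "v \<in> frontier \<Omega>" "norm v < d" by auto
    then show False using infdist_le[of v "frontier \<Omega>" 0] w(2) by (simp add: d_def)
  qed
  obtain g where g: "g holomorphic_on \<Omega>"
    "\<And>z. z \<in> \<bbbD> \<Longrightarrow> deriv f z * deriv g (f z) = 1" "\<And>z. z \<in> \<bbbD> \<Longrightarrow> g (f z) = z"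
    using holomorphic_has_inverse[OF hol _ inj] unfolding \<Omega>_def by (metis open_ball)
  define u where "u = w / of_real d"
  have nu: "norm u = 1" using d by (simp add: u_def d_def norm_divide)
  have ray: "of_real t * u \<in> \<Omega>" if "0 \<le> t" "t < d" for t
    using that ball by (auto simp: norm_mult nu)
  have gD: "g v \<in> \<bbbD>" "f (g v) = v" if "v \<in> \<Omega>" for v
    using that g(3) unfolding \<Omega>_def by auto
  define N where "N t = norm (g (of_real t * u))" for t :: real
  have N1: "0 \<le> N t" "N t < 1" if "0 \<le> t" "t < d" for t
    using gD(1)[OF ray[OF that]] by (auto simp: N_def)
  have KN: "K (N t) \<le> t" if t: "0 \<le> t" "t < d" for t
  proof -
    have "0 - K (N 0) \<le> t - K (N t)"
    proof (rule DERIV_nonneg_imp_increasing_open[OF t(1)])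
      fix s assume "0 < s" "s < t"
      then have s: "0 < s" "0 \<le> s" "s < d" using t by auto
      define v where "v = of_real s * u"
      have v: "v \<in> \<Omega>" unfolding v_def using ray s by simp
      \<comment> \<open>This keeps the curve away from the origin, where the norm is not
        differentiable.\<close>
      have "g v \<noteq> 0" using gD(2)[OF v] f0 s nu by (auto simp: v_def)
      have "((\<lambda>s. of_real s * u) has_vector_derivative u) (at s)"
        by (rule has_vector_derivative_real_field) (auto intro!: derivative_eq_intros)
      then have "((g \<circ> (\<lambda>s. of_real s * u)) has_vector_derivative u * deriv g v) (at s)"
        unfolding v_def
        by (rule field_vector_diff_chain_at[OF _ holomorphic_derivI[OF g(1) \<open>open \<Omega>\<close>]])
          (use v in \<open>simp add: v_def\<close>)
      then have "((norm \<circ> (g \<circ> (\<lambda>s. of_real s * u))) has_derivative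
          (\<lambda>h. inner h (sgn (g v))) \<circ> (\<lambda>h. h *\<^sub>R (u * deriv g v))) (at s)"
        unfolding has_vector_derivative_def
        by (rule diff_chain_at) (use \<open>g v \<noteq> 0\<close> in \<open>auto simp: v_def intro: has_derivative_norm\<close>)
      moreover have "(\<lambda>h. inner h (sgn (g v))) \<circ> (\<lambda>h. h *\<^sub>R (u * deriv g v))
          = (*) (inner (u * deriv g v) (sgn (g v)))"
        by (rule ext) simp
      moreover have "norm \<circ> (g \<circ> (\<lambda>s. of_real s * u)) = N"
        by (rule ext) (simp add: N_def)
      ultimately have N': "(N has_real_derivative inner (u * deriv g v) (sgn (g v))) (at s)"
        by (simp only: has_field_derivative_def)
      have "inner (u * deriv g v) (sgn (g v)) \<le> norm (u * deriv g v) * norm (sgn (g v))"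
        by (rule norm_cauchy_schwarz)
      also have "\<dots> = norm (deriv g v)"
        using \<open>g v \<noteq> 0\<close> by (simp add: norm_mult nu norm_sgn)
      finally have le: "inner (u * deriv g v) (sgn (g v)) \<le> norm (deriv g v)" .
      have Ns: "0 < N s" "N s < 1" using \<open>g v \<noteq> 0\<close> N1[OF s(2,3)] by (auto simp: N_def v_def)
      have "\<kappa> (N s) * inner (u * deriv g v) (sgn (g v)) \<le> norm (deriv f (g v)) * norm (deriv g v)"
      proof -
        have "\<kappa> (N s) * inner (u * deriv g v) (sgn (g v)) \<le> \<kappa> (N s) * norm (deriv g v)"
          using le \<kappa>[OF Ns] by (intro mult_left_mono) auto
        also have "\<dots> \<le> norm (deriv f (g v)) * norm (deriv g v)"
          using f'[OF gD(1)[OF v] \<open>g v \<noteq> 0\<close>] by (intro mult_right_mono) (auto simp: N_def v_def)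
        finally show ?thesis .
      qed
      also have "\<dots> = 1"
        using g(2)[OF gD(1)[OF v]] gD(2)[OF v] by (metis norm_mult norm_one)
      finally have "0 \<le> 1 - \<kappa> (N s) * inner (u * deriv g v) (sgn (g v))" by simp
      moreover have "((\<lambda>s. s - K (N s)) has_real_derivative
          1 - \<kappa> (N s) * inner (u * deriv g v) (sgn (g v))) (at s)"
        by (intro DERIV_diff DERIV_ident DERIV_chain2[OF K'[OF Ns] N'])
      ultimately show "\<exists>y. ((\<lambda>s. s - K (N s)) has_real_derivative y) (at s) \<and> 0 \<le> y" by blast
    next
      have "continuous_on {0..t} N"
        unfolding N_def
        by (intro continuous_intros continuous_on_compose2[OF holomorphic_on_imp_continuous_on[OF g(1)]])
          (use t ray in auto)
      then show "continuous_on {0..t} (\<lambda>s. s - K (N s))"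
        by (intro continuous_intros continuous_on_compose2[OF K_cont]) (use t N1 in auto)
    qed
    moreover have "g 0 = 0" using g(3)[of 0] f0 by simp
    ultimately show ?thesis by (simp add: N_def K0)
  qed
  \<comment> \<open>The image of the smaller closed disc is compact and misses w, so points of the
    segment close enough to w have preimages of modulus greater than \<rho>.\<close>
  have "closed (f ` cball 0 \<rho>)"
    using \<rho> by (intro compact_imp_closed compact_continuous_image
        holomorphic_on_imp_continuous_on holomorphic_on_subset[OF hol]) auto
  moreover have "w \<notin> f ` cball 0 \<rho>" using w\<Omega> \<rho> by (auto simp: \<Omega>_def)
  ultimately obtain e where e: "e > 0" "ball w e \<inter> f ` cball 0 \<rho> = {}"
    by (metis Compl_iff disjoint_eq_subset_Compl open_Compl open_contains_ball)
  \<comment> \<open>The maximum with 0 keeps t in [0,d) when e/2 exceeds d.\<close>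
  define t where "t = max 0 (d - e / 2)"
  have t: "0 \<le> t" "t < d" using d e by (auto simp: t_def)
  have "w - of_real t * u = of_real (d - t) * u"
    using d by (simp add: u_def field_simps)
  then have "dist w (of_real t * u) = d - t"
    using t by (simp add: dist_norm norm_mult nu del: of_real_diff)
  then have "of_real t * u \<in> ball w e" using e t by (auto simp: t_def)
  then have "N t > \<rho>"
    using e(2) gD(2)[OF ray[OF t]] unfolding N_def by (metis IntI empty_iff image_eqI mem_cball_0 not_le)
  have "K \<rho> \<le> K (N t)"
  proof (rule DERIV_nonneg_imp_increasing_open[where f = K and a = \<rho> and b = "N t"])
    show "\<rho> \<le> N t" using \<open>N t > \<rho>\<close> by simp
    show "continuous_on {\<rho>..N t} K"
      by (rule continuous_on_subset[OF K_cont]) (use \<rho> N1[OF t] in auto)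
  next
    fix x assume "\<rho> < x" "x < N t"
    then have "0 < x" "x < 1" using \<rho> N1[OF t] by auto
    then show "\<exists>y. (K has_real_derivative y) (at x) \<and> 0 \<le> y"
      using K' \<kappa> by (meson less_imp_le)
  qed
  also have "\<dots> \<le> d" using KN[OF t] t by simp
  finally show ?thesis using w(2) by (simp add: \<Omega>_def d_def)
qed

section \<open>Taylor expansions of functions on the disc, and monotone limits\<close>

lemma disc_fps_expansion:
  assumes "f holomorphic_on \<bbbD>"
  shows "f has_fps_expansion fps_expansion f 0"
  using assms by (intro has_fps_expansion_fps_expansion[of \<bbbD>]) auto

lemma fps_expansion_eq_Abs_fps:
  fixes f :: "complex \<Rightarrow> complex"
  assumes "\<And>z. z \<in> \<bbbD> \<Longrightarrow> (\<lambda>n. c n * z ^ n) sums f z"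
  shows "fps_expansion f 0 = Abs_fps c"
proof -
  have "\<forall>\<^sub>F z in nhds 0. z \<in> \<bbbD>" by (intro eventually_nhds_in_open) auto
  then have "f has_fps_expansion Abs_fps c"
    by (intro has_fps_expansionI) (auto elim!: eventually_mono simp: assms)
  then show ?thesis by (rule fps_expansion_eqI)
qed

text \<open>Turns the differential equation into the formal identity required by the comparison
  lemmas, by uniqueness of expansions at 0.\<close>

lemma fps_expansion_logarithmic_derivative:
  assumes u: "u holomorphic_on \<bbbD>" and p: "p holomorphic_on \<bbbD>"
    and eq: "\<And>z. z \<in> \<bbbD> \<Longrightarrow> z * deriv u z = p z * u z"
  shows "fps_X * fps_deriv (fps_expansion u 0) = fps_expansion p 0 * fps_expansion u 0"
proof -
  have "(\<lambda>z. z * deriv u z) has_fps_expansion fps_X * fps_deriv (fps_expansion u 0)"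
    by (intro fps_expansion_intros disc_fps_expansion u)
  moreover have "(\<lambda>z. p z * u z) has_fps_expansion fps_expansion p 0 * fps_expansion u 0"
    by (intro fps_expansion_intros disc_fps_expansion u p)
  moreover have "\<forall>\<^sub>F z in nhds 0. z * deriv u z = p z * u z"
    using eventually_nhds_in_open[of \<bbbD> 0] by (auto elim!: eventually_mono simp: eq)
  then have "(\<lambda>z. z * deriv u z) has_fps_expansion F \<longleftrightarrow> (\<lambda>z. p z * u z) has_fps_expansion F" for F
    by (rule has_fps_expansion_cong) simp
  ultimately show ?thesis
    using fps_expansion_unique_complex by blast
qed

text \<open>Nonnegative real coefficients equal their norms, so the left side is a partial sum of a
  convergent series with nonnegative terms.\<close>

lemma fps_partial_sum_le_Re:
  assumes f: "f holomorphic_on \<bbbD>"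
    and coeffs: "\<And>n. fps_nth (fps_expansion f 0) n \<in> \<real>" "\<And>n. 0 \<le> Re (fps_nth (fps_expansion f 0) n)"
    and t: "0 \<le> t" "t < 1"
  shows "(\<Sum>n\<le>N. norm (fps_nth (fps_expansion f 0) n) * t ^ n) \<le> Re (f (of_real t))"
proof -
  have norm_eq: "norm (fps_nth (fps_expansion f 0) n) = Re (fps_nth (fps_expansion f 0) n)" for n
    using coeffs[of n] by (auto elim!: Reals_cases)
  have "(\<lambda>n. Re (fps_nth (fps_expansion f 0) n * of_real t ^ n)) sums Re (f (of_real t))"
    using t by (intro sums_Re disc_power_series f) auto
  then have s: "(\<lambda>n. norm (fps_nth (fps_expansion f 0) n) * t ^ n) sums Re (f (of_real t))"
    by (simp add: norm_eq flip: of_real_power)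
  then show ?thesis
    using sum_le_suminf[OF sums_summable[OF s], of "{..N}"] t by (simp add: sums_unique[OF s])
qed

text \<open>The limit is the supremum. Its existence matters because \<open>Lim\<close> is
  meaningful for the radial limit of \<open>k\<close> only if there is one.\<close>

lemma mono_bounded_tendsto_at_left:
  fixes K :: "real \<Rightarrow> real"
  assumes mono: "\<And>s t. a \<le> s \<Longrightarrow> s \<le> t \<Longrightarrow> t < b \<Longrightarrow> K s \<le> K t" and ab: "a < b"
    and bd: "\<And>t. a \<le> t \<Longrightarrow> t < b \<Longrightarrow> K t \<le> d"
  obtains l where "(K \<longlongrightarrow> l) (at_left b)" "\<And>t. a \<le> t \<Longrightarrow> t < b \<Longrightarrow> K t \<le> l" "l \<le> d"
proof
  define l where "l = (SUP t\<in>{a..<b}. K t)"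
  have bdd: "bdd_above (K ` {a..<b})" using bd by (auto intro!: bdd_aboveI[of _ d])
  show le: "K t \<le> l" if "a \<le> t" "t < b" for t
    unfolding l_def using that bdd by (intro cSUP_upper) auto
  show "l \<le> d" unfolding l_def using ab bd by (intro cSUP_least) auto
  show "(K \<longlongrightarrow> l) (at_left b)"
  proof (rule increasing_tendsto)
    show "\<forall>\<^sub>F t in at_left b. K t \<le> l"
      by (rule eventually_at_leftI[of a]) (use le ab in auto)
    fix x assume "x < l"
    then obtain s where s: "a \<le> s" "s < b" "x < K s"
      unfolding l_def using less_cSUP_iff[OF _ bdd] ab by auto
    show "\<forall>\<^sub>F t in at_left b. x < K t"
    proof (rule eventually_at_leftI)
      fix t assume "t \<in> {s<..<b}"
      then show "x < K t" using mono[of s t] s by auto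
    qed (use s in simp)
  qed
qed

section \<open>The extremal function\<close>

lemma class_C_E:
  assumes "f \<in> class_C \<phi>"
  obtains \<omega> where "f holomorphic_on \<bbbD>" "f 0 = 0" "deriv f 0 = 1"
    "\<And>z. z \<in> \<bbbD> \<Longrightarrow> deriv f z \<noteq> 0"
    "\<omega> holomorphic_on \<bbbD>" "\<omega> ` \<bbbD> \<subseteq> \<bbbD>" "\<omega> 0 = 0"
    "\<And>z. z \<in> \<bbbD> \<Longrightarrow> convex_op f z = \<phi> (\<omega> z)"
proof -
  have hol: "f holomorphic_on \<bbbD>" and inj: "inj_on f \<bbbD>" and "f 0 = 0" "deriv f 0 = 1"
    using assms by (auto simp: class_C_def class_S_def class_A_def)
  moreover have "deriv f z \<noteq> 0" if "z \<in> \<bbbD>" for z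
    using holomorphic_injective_imp_regular[OF hol _ inj that] by simp
  ultimately show thesis
    using assms that by (auto simp: class_C_def subordinate_def)
qed

text \<open>Nonnegative coefficients drive the majorant estimates; strict positivity of the first
  one yields the existence of the root.\<close>

locale ma_minda_extremal = real_univalent +
  fixes k :: "complex \<Rightarrow> complex"
  assumes \<phi>0: "\<phi> 0 = 1"
    and coeffs_nonneg: "\<And>n. 0 \<le> Re (fps_nth (fps_expansion \<phi> 0) n)"
    and coeff1_pos: "0 < Re (fps_nth (fps_expansion \<phi> 0) 1)"
    and k: "extremal_function \<phi> k"
begin

text \<open>Here and in \<open>kr\<close> the real part only changes the type: k and its derivative
  have real coefficients and are real on (-1,1).\<close>

definition \<kappa> :: "real \<Rightarrow> real" where "\<kappa> t = Re (deriv k (of_real t))"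

definition kr :: "real \<Rightarrow> real" where "kr t = Re (k (of_real t))"

lemma k_hol: "k holomorphic_on \<bbbD>" and k_inj: "inj_on k \<bbbD>"
  and k0: "k 0 = 0" and k'0: "deriv k 0 = 1"
  using k by (auto simp: extremal_function_def class_S_def class_A_def)

lemma k'_nonzero: "z \<in> \<bbbD> \<Longrightarrow> deriv k z \<noteq> 0"
  using holomorphic_injective_imp_regular[OF k_hol _ k_inj] by auto

lemma k'_hol: "deriv k holomorphic_on \<bbbD>"
  by (intro holomorphic_deriv k_hol) auto

lemma k_ode:
  assumes "z \<in> \<bbbD>"
  shows "z * deriv (deriv k) z = (\<phi> z - 1) * deriv k z"
proof -
  have "\<phi> z - 1 = z * deriv (deriv k) z / deriv k z"
    using k assms unfolding extremal_function_def convex_op_def by (metis add_diff_cancel_left')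
  then show ?thesis using k'_nonzero[OF assms] by simp
qed

lemma phi_minus_1_expansion: "fps_expansion (\<lambda>z. \<phi> z - 1) 0 = fps_expansion \<phi> 0 - 1"
  by (intro fps_expansion_unique_complex[OF disc_fps_expansion] fps_expansion_intros
      disc_fps_expansion holomorphic_intros hol)

lemma phi_minus_1_coeffs:
  "fps_nth (fps_expansion \<phi> 0 - 1) n \<in> \<real>" "0 \<le> Re (fps_nth (fps_expansion \<phi> 0 - 1) n)"
  "fps_nth (fps_expansion \<phi> 0 - 1) 0 = 0"
  using coeffs_real[of n] coeffs_nonneg[of n] \<phi>0
  by (cases "n = 0"; auto simp: fps_expansion_def)+

lemma k'_eq: "fps_X * fps_deriv (fps_expansion (deriv k) 0)
    = (fps_expansion \<phi> 0 - 1) * fps_expansion (deriv k) 0"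
proof -
  have "(\<lambda>z. \<phi> z - 1) holomorphic_on \<bbbD>" by (intro holomorphic_intros hol)
  from fps_expansion_logarithmic_derivative[OF k'_hol this k_ode]
  show ?thesis by (simp add: phi_minus_1_expansion)
qed

lemma k'_coeff0: "fps_nth (fps_expansion (deriv k) 0) 0 = 1"
  by (simp add: fps_expansion_def k'0)

lemma k'_coeffs: "fps_nth (fps_expansion (deriv k) 0) n \<in> \<real>"
  "0 \<le> Re (fps_nth (fps_expansion (deriv k) 0) n)"
  using fps_logarithmic_derivative_nonneg[OF k'_eq phi_minus_1_coeffs k'_coeff0] by auto

lemma k_coeff_Suc: "fps_nth (fps_expansion k 0) (Suc n)
    = fps_nth (fps_expansion (deriv k) 0) n / of_nat (Suc n)"
  unfolding fps_expansion_deriv by (simp del: of_nat_Suc)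

lemma k_coeffs: "fps_nth (fps_expansion k 0) n \<in> \<real>" "0 \<le> Re (fps_nth (fps_expansion k 0) n)"
proof -
  have "fps_nth (fps_expansion k 0) 0 = 0" by (simp add: fps_expansion_def k0)
  then show "fps_nth (fps_expansion k 0) n \<in> \<real>" "0 \<le> Re (fps_nth (fps_expansion k 0) n)"
    using k'_coeffs by (cases n; auto simp: k_coeff_Suc Re_divide_of_nat simp del: of_nat_Suc)+
qed

text \<open>Coefficient 1 of the differential equation shows that k' has the same first coefficient
  as \<phi>; the second coefficient of k is half of it.\<close>

lemma k_coeff2_pos: "0 < Re (fps_nth (fps_expansion k 0) 2)"
proof -
  have "fps_nth (fps_expansion (deriv k) 0) 1 = fps_nth (fps_X * fps_deriv (fps_expansion (deriv k) 0)) 1"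
    by simp
  also have "\<dots> = fps_nth (fps_expansion \<phi> 0) 1"
    unfolding k'_eq fps_mult_nth_1 phi_minus_1_coeffs(3) k'_coeff0 by simp
  finally show ?thesis
    using coeff1_pos by (simp add: numeral_2_eq_2 k_coeff_Suc Re_divide_of_nat del: of_nat_Suc)
qed

lemma k_real: "\<bar>t\<bar> < 1 \<Longrightarrow> k (of_real t) = of_real (kr t)"
  using real_on_reals[OF k_hol k_coeffs(1)] by (simp add: kr_def)

lemma \<kappa>_pos: "\<bar>t\<bar> < 1 \<Longrightarrow> 0 < \<kappa> t"
  unfolding \<kappa>_def using positive_on_reals[OF k'_hol k'_coeffs(1) k'_nonzero] by (simp add: k'0)

lemma kr_deriv: "\<bar>t\<bar> < 1 \<Longrightarrow> (kr has_real_derivative \<kappa> t) (at t)"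
  unfolding kr_def \<kappa>_def by (rule Re_on_reals_has_derivative[OF k_hol])

lemma kr_0: "kr 0 = 0" and \<kappa>_0: "\<kappa> 0 = 1"
  by (simp_all add: kr_def \<kappa>_def k0 k'0)

lemma \<kappa>_deriv:
  assumes t: "\<bar>t\<bar> < 1" "t \<noteq> 0"
  shows "(\<kappa> has_real_derivative (Re (\<phi> (of_real t)) - 1) * \<kappa> t / t) (at t)"
proof -
  have "\<phi> (of_real t) \<in> \<real>" by (rule real_on_reals[OF hol coeffs_real t(1)])
  then have "Re ((\<phi> (of_real t) - 1) * deriv k (of_real t)) = (Re (\<phi> (of_real t)) - 1) * \<kappa> t"
    by (auto simp: \<kappa>_def elim!: Reals_cases)
  moreover have "Re (of_real t * deriv (deriv k) (of_real t)) = Re ((\<phi> (of_real t) - 1) * deriv k (of_real t))"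
    using k_ode[of "of_real t"] t by simp
  ultimately have "Re (deriv (deriv k) (of_real t)) = (Re (\<phi> (of_real t)) - 1) * \<kappa> t / t"
    using t(2) by (simp add: field_simps)
  then show ?thesis
    using Re_on_reals_has_derivative[OF k'_hol t(1)] by (simp add: \<kappa>_def[abs_def])
qed

lemma \<kappa>_isCont: "\<bar>t\<bar> < 1 \<Longrightarrow> isCont \<kappa> t"
  unfolding \<kappa>_def[abs_def] using Re_on_reals_has_derivative[OF k'_hol] DERIV_isCont by blast

lemma kr_strict_mono:
  assumes "-1 < s" "s < t" "t < 1"
  shows "kr s < kr t"
proof (rule DERIV_pos_imp_increasing[OF assms(2)])
  fix x assume "s \<le> x" "x \<le> t"
  then have "\<bar>x\<bar> < 1" using assms by auto
  then show "\<exists>y. (kr has_real_derivative y) (at x) \<and> y > 0" using kr_deriv \<kappa>_pos by blast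
qed

text \<open>Odd powers cancel and even ones double. All remaining terms are nonnegative, and only
  the quadratic one is kept.\<close>

lemma kr_add_kr_minus_ge:
  assumes s: "0 \<le> s" "s < 1"
  shows "2 * Re (fps_nth (fps_expansion k 0) 2) * s\<^sup>2 \<le> kr s + kr (- s)"
proof -
  let ?c = "\<lambda>n. Re (fps_nth (fps_expansion k 0) n)"
  have sums: "(\<lambda>n. ?c n * t ^ n) sums kr t" if "\<bar>t\<bar> < 1" for t
    using sums_Re[OF disc_power_series[OF k_hol, of "of_real t"]] that
    by (simp add: kr_def flip: of_real_power)
  have sums2: "(\<lambda>n. ?c n * s ^ n + ?c n * (- s) ^ n) sums (kr s + kr (- s))"
    by (intro sums_add sums) (use s in auto)
  have "0 \<le> ?c n * s ^ n + ?c n * (- s) ^ n" for n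
    using k_coeffs(2)[of n] s by (cases "even n") auto
  then have "(\<Sum>n\<in>{2}. ?c n * s ^ n + ?c n * (- s) ^ n) \<le> kr s + kr (- s)"
    unfolding sums_unique[OF sums2] by (intro sum_le_suminf sums_summable[OF sums2]) auto
  then show ?thesis by (simp add: mult_ac)
qed

text \<open>As f' has no zeros, f' = exp L with L(0) = 0 and z L'(z) = \<phi>(\<omega>(z)) -
  \<phi>(0). The comparison function is ln \<kappa>(-r), with derivative (\<phi>(-r) - \<phi>(0))/r,
  so \<open>Re_integral_subordinate_ge\<close> bounds ln |f'| = Re L from below.\<close>

lemma norm_deriv_ge:
  assumes f: "f \<in> class_C \<phi>" and z: "z \<in> \<bbbD>"
  shows "\<kappa> (- norm z) \<le> norm (deriv f z)"
proof -
  obtain \<omega> where f_hol: "f holomorphic_on \<bbbD>" and f'0: "deriv f 0 = 1"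
    and nz: "\<And>z. z \<in> \<bbbD> \<Longrightarrow> deriv f z \<noteq> 0"
    and \<omega>: "\<omega> holomorphic_on \<bbbD>" "\<omega> ` \<bbbD> \<subseteq> \<bbbD>" "\<omega> 0 = 0"
    and \<omega>_eq: "\<And>z. z \<in> \<bbbD> \<Longrightarrow> convex_op f z = \<phi> (\<omega> z)"
    using class_C_E[OF f] by metis
  have f'_hol: "deriv f holomorphic_on \<bbbD>" by (intro holomorphic_deriv f_hol) auto
  obtain l where l: "l holomorphic_on \<bbbD>" "\<And>z. z \<in> \<bbbD> \<Longrightarrow> deriv f z = exp (l z)"
    using simply_connected_imp_holomorphic_log[OF f'_hol _ _ nz]
    by (metis convex_ball convex_imp_simply_connected convex_imp_locally_path_connected)
  \<comment> \<open>The shift makes L vanish at 0; it does not alter the exponential since exp(l(0))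
    = f'(0) = 1.\<close>
  define L where "L z = l z - l 0" for z
  have L: "L holomorphic_on \<bbbD>" "L 0 = 0"
    unfolding L_def by (auto intro!: holomorphic_intros l)
  have exp_l0: "exp (l 0) = 1" using l(2)[of 0] f'0 by simp
  have f'_exp: "deriv f z = exp (L z)" if "z \<in> \<bbbD>" for z
    using l(2)[OF that] by (simp add: L_def exp_diff exp_l0)
  have "z * deriv L z = \<phi> (\<omega> z) - \<phi> 0" if z: "z \<in> \<bbbD>" for z
  proof -
    have "((\<lambda>z. exp (L z)) has_field_derivative exp (L z) * deriv L z) (at z)"
      using holomorphic_derivI[OF L(1) _ z] by (auto intro!: derivative_eq_intros)
    moreover have "\<forall>\<^sub>F w in nhds z. w \<in> \<bbbD>"
      using z by (intro eventually_nhds_in_open) auto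
    then have "\<forall>\<^sub>F w in nhds z. deriv f w = exp (L w)"
      by (rule eventually_mono) (rule f'_exp)
    ultimately have "deriv (deriv f) z = exp (L z) * deriv L z"
      using DERIV_imp_deriv deriv_cong_ev by metis
    then have "deriv (deriv f) z / deriv f z = deriv L z"
      using f'_exp[OF z] by simp
    then show ?thesis
      using \<omega>_eq[OF z] by (simp add: convex_op_def \<phi>0 flip: times_divide_eq_right) (metis add_diff_cancel_left')
  qed
  moreover have "((\<lambda>r. ln (\<kappa> (- r))) has_real_derivative
      (Re (\<phi> (of_real (- r))) - Re (\<phi> 0)) / r) (at r)" if r: "0 < r" "r < 1" for r
  proof -
    have pos: "\<kappa> (- r) > 0" using r by (intro \<kappa>_pos) auto
    have "((\<lambda>r. \<kappa> (- r)) has_real_derivative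
        (Re (\<phi> (of_real (- r))) - 1) * \<kappa> (- r) / (- r) * (- 1)) (at r)"
      by (rule DERIV_chain2[OF \<kappa>_deriv]) (use r in \<open>auto intro!: derivative_eq_intros\<close>)
    from DERIV_chain2[where f = ln, OF DERIV_ln_divide[OF pos] this]
    have "((\<lambda>r. ln (\<kappa> (- r))) has_real_derivative
        1 / \<kappa> (- r) * ((Re (\<phi> (of_real (- r))) - 1) * \<kappa> (- r) / (- r) * (- 1))) (at r)" .
    moreover have "1 / \<kappa> (- r) * ((Re (\<phi> (of_real (- r))) - 1) * \<kappa> (- r) / (- r) * (- 1))
        = (Re (\<phi> (of_real (- r))) - Re (\<phi> 0)) / r"
      using pos r by (simp add: \<phi>0)
    ultimately show ?thesis by (simp only:)
  qed
  moreover have "continuous_on {0..<1} (\<lambda>r. ln (\<kappa> (- r)))"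
  proof (rule continuous_at_imp_continuous_on, rule ballI)
    fix r :: real assume r: "r \<in> {0..<1}"
    have "isCont (\<lambda>r. \<kappa> (- r)) r"
      by (rule isCont_o2[OF _ \<kappa>_isCont]) (use r in auto)
    then show "isCont (\<lambda>r. ln (\<kappa> (- r))) r"
      using \<kappa>_pos[of "- r"] r by (intro isCont_ln') auto
  qed
  ultimately have "ln (\<kappa> (- norm z)) \<le> Re (L z)"
    using z by (intro Re_integral_subordinate_ge[OF L \<omega>]) (auto simp: \<kappa>_0)
  then have "exp (ln (\<kappa> (- norm z))) \<le> exp (Re (L z))"
    by (simp only: exp_le_cancel_iff)
  moreover have "exp (ln (\<kappa> (- norm z))) = \<kappa> (- norm z)"
    using \<kappa>_pos[of "- norm z"] z by simp
  ultimately show ?thesis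
    using f'_exp[OF z] by simp
qed

text \<open>The growth lemma with K(r) = -k(-r), whose derivative k'(-r) is a lower bound for |f'|
  on the circle of radius r.\<close>

lemma growth_le_infdist:
  assumes f: "f \<in> class_C \<phi>" and \<rho>: "0 \<le> \<rho>" "\<rho> < 1"
  shows "- kr (- \<rho>) \<le> infdist (f 0) (frontier (f ` \<bbbD>))"
proof -
  have f_hol: "f holomorphic_on \<bbbD>" and f_inj: "inj_on f \<bbbD>" and f0: "f 0 = 0"
    using f by (auto simp: class_C_def class_S_def class_A_def)
  have der: "((\<lambda>r. - kr (- r)) has_real_derivative \<kappa> (- r)) (at r)" if "0 \<le> r" "r < 1" for r
    by (rule derivative_eq_intros DERIV_chain2[OF kr_deriv] | use that in simp)+
  have cont: "continuous_on {0..<1} (\<lambda>r. - kr (- r))"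
    by (rule continuous_at_imp_continuous_on) (auto intro!: DERIV_isCont[OF der])
  show ?thesis
    unfolding f0
    by (rule growth_le_infdist_frontier[where \<kappa> = "\<lambda>r. \<kappa> (- r)", OF f_hol f_inj f0 _ cont der _ _ \<rho>])
      (auto simp: kr_0 \<kappa>_pos norm_deriv_ge[OF f])
qed

text \<open>Bohr's inequality bounds the majorant of \<phi> \<circ> \<omega> - 1 by \<phi>(s) - 1;
  the differential equation carries this over to f' against k', and integration to f against
  k.\<close>

lemma bohr_sum_le:
  assumes f: "f \<in> class_C \<phi>" and t: "0 \<le> t" "t \<le> 1 / 3"
  shows "(\<Sum>n\<le>Suc N. norm (fps_nth (fps_expansion f 0) n) * t ^ n) \<le> kr t"
proof -
  obtain \<omega> where f_hol: "f holomorphic_on \<bbbD>" and f0: "f 0 = 0" and f'0: "deriv f 0 = 1"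
    and nz: "\<And>z. z \<in> \<bbbD> \<Longrightarrow> deriv f z \<noteq> 0"
    and \<omega>: "\<omega> holomorphic_on \<bbbD>" "\<omega> ` \<bbbD> \<subseteq> \<bbbD>" "\<omega> 0 = 0"
    and \<omega>_eq: "\<And>z. z \<in> \<bbbD> \<Longrightarrow> convex_op f z = \<phi> (\<omega> z)"
    using class_C_E[OF f] by metis
  have f'_hol: "deriv f holomorphic_on \<bbbD>" by (intro holomorphic_deriv f_hol) auto
  define h where "h z = \<phi> z - 1" for z
  have h_hol: "h holomorphic_on \<bbbD>" unfolding h_def by (intro holomorphic_intros hol)
  have h_exp: "fps_expansion h 0 = fps_expansion \<phi> 0 - 1"
    using phi_minus_1_expansion by (simp add: h_def[abs_def])
  have p_hol: "(h \<circ> \<omega>) holomorphic_on \<bbbD>"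
    by (intro holomorphic_on_compose_gen[OF \<omega>(1) h_hol] \<omega>(2))
  have ode: "z * deriv (deriv f) z = (h \<circ> \<omega>) z * deriv f z" if "z \<in> \<bbbD>" for z
    using \<omega>_eq[OF that] nz[OF that] by (auto simp: convex_op_def h_def field_simps)
  have W0: "fps_nth (fps_expansion \<omega> 0) 0 = 0" by (simp add: fps_expansion_def \<omega>)
  have p_exp: "fps_expansion (h \<circ> \<omega>) 0 = fps_expansion h 0 oo fps_expansion \<omega> 0"
    by (intro fps_expansion_unique_complex[OF disc_fps_expansion[OF p_hol]]
        has_fps_expansion_compose disc_fps_expansion h_hol \<omega> W0)
  have maj: "(\<Sum>j\<le>N. norm (fps_nth (fps_expansion (h \<circ> \<omega>) 0) j) * s ^ j) \<le> Re (\<phi> (of_real s)) - 1"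
    if s: "0 < s" "s < 1/3" for s
  proof -
    have "(\<Sum>j\<le>N. norm (fps_nth (fps_expansion (h \<circ> \<omega>) 0) j) * s ^ j)
        \<le> (\<Sum>i\<le>N. norm (fps_nth (fps_expansion h 0) i) * s ^ i)"
      unfolding p_exp by (intro fps_compose_majorant schwarz_majorant_le \<omega>) (use s in auto)
    also have "\<dots> \<le> Re (h (of_real s))"
      by (intro fps_partial_sum_le_Re h_hol) (use s phi_minus_1_coeffs in \<open>simp_all add: h_exp del: fps_sub_nth\<close>)
    finally show ?thesis by (simp add: h_def)
  qed
  have f'_maj: "(\<Sum>n\<le>N. norm (fps_nth (fps_expansion (deriv f) 0) n) * s ^ n) \<le> \<kappa> s"
    if s: "0 \<le> s" "s \<le> 1/3" for s
  proof (rule fps_logarithmic_derivative_majorant[OF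
        fps_expansion_logarithmic_derivative[OF f'_hol p_hol ode] maj _ _ _ _ s])
    show "continuous_on {0..1/3} \<kappa>"
      by (rule continuous_at_imp_continuous_on) (auto intro!: \<kappa>_isCont)
    show "norm (fps_nth (fps_expansion (deriv f) 0) 0) \<le> \<kappa> 0"
      by (simp add: fps_expansion_def f'0 \<kappa>_0)
  qed (auto intro!: \<kappa>_deriv \<kappa>_pos)
  show ?thesis
  proof (rule fps_antiderivative_majorant[OF _ _ _ t])
    show "(\<Sum>n\<le>N. norm (fps_nth (fps_deriv (fps_expansion f 0)) n) * s ^ n) \<le> \<kappa> s"
      if "0 < s" "s < 1/3" for s
      using f'_maj[of s] that by (simp add: fps_expansion_deriv)
    show "norm (fps_nth (fps_expansion f 0) 0) \<le> kr 0"
      by (simp add: fps_expansion_def f0 kr_0)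
  qed (auto intro!: kr_deriv)
qed

end

section \<open>Existence of the root and comparison of k(r) with -k(-1)\<close>

theorem theorem2p10:
  fixes \<phi> k f :: "complex \<Rightarrow> complex" and B :: "nat \<Rightarrow> real" and a :: "nat \<Rightarrow> complex"
  assumes "ma_minda \<phi>"
    and "\<And>z. z \<in> \<bbbD> \<Longrightarrow> (\<lambda>n. of_real (B (n + 1)) * z ^ (n + 1)) sums (\<phi> z - 1)"
    and "\<And>n. n \<ge> 1 \<Longrightarrow> B n > 0"
    and "\<phi> \<in> hardy_H2"
    and "extremal_function \<phi> k"
    and "f \<in> class_C \<phi>"
    and "\<And>z. z \<in> \<bbbD> \<Longrightarrow> (\<lambda>n. a (n + 2) * z ^ (n + 2)) sums (f z - z)"
  shows "\<exists>r\<^sub>f. smallest_root k r\<^sub>f \<and>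
           (\<forall>z::complex. norm z \<le> min r\<^sub>f (1 / 3) \<longrightarrow>
              norm z + (\<Sum>n. norm (a (n + 2)) * norm z ^ (n + 2))
                \<le> infdist (f 0) (frontier (f ` \<bbbD>)))"
proof -
  \<comment> \<open>The constant term is entered by hand, as \<open>B 0\<close> is unconstrained.
    The same is done below for \<open>a 0\<close> and \<open>a 1\<close>.\<close>
  have "(\<lambda>n. (if n = 0 then 1 else of_real (B n)) * z ^ n) sums \<phi> z" if "z \<in> \<bbbD>" for z
    using assms(2)[OF that]
      sums_Suc_iff[of "\<lambda>n. (if n = 0 then 1 else of_real (B n)) * z ^ n" "\<phi> z - 1"]
    by simp
  then have \<phi>_exp: "fps_expansion \<phi> 0 = Abs_fps (\<lambda>n. if n = 0 then 1 else of_real (B n))"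
    by (rule fps_expansion_eq_Abs_fps)
  interpret ma_minda_extremal \<phi> k
    by unfold_locales (use assms(1,3,5) in \<open>auto simp: ma_minda_def \<phi>_exp less_imp_le\<close>)
  have f_exp: "fps_expansion f 0 = Abs_fps (\<lambda>n. if n = 0 then 0 else if n = 1 then 1 else a n)"
  proof (rule fps_expansion_eq_Abs_fps)
    fix z assume "z \<in> \<bbbD>"
    from assms(7)[OF this] show "(\<lambda>n. (if n = 0 then 0 else if n = 1 then 1 else a n) * z ^ n) sums f z"
      using sums_iff_shift[of "\<lambda>n. (if n = 0 then 0 else if n = 1 then 1 else a n) * z ^ n" 2 "f z - z"]
      by (simp add: numeral_2_eq_2)
  qed
  define d where "d = infdist (f 0) (frontier (f ` \<bbbD>))"
  \<comment> \<open>The number l is -k(-1): a limit of increasing values, all bounded by the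
    distance d.\<close>
  obtain l where l: "((\<lambda>r. - kr (- r)) \<longlongrightarrow> l) (at_left 1)"
    "\<And>r. 0 \<le> r \<Longrightarrow> r < 1 \<Longrightarrow> - kr (- r) \<le> l" "l \<le> d"
  proof (rule mono_bounded_tendsto_at_left)
    show "- kr (- s) \<le> - kr (- t)" if "0 \<le> s" "s \<le> t" "t < 1" for s t
      using kr_strict_mono[of "- t" "- s"] that by (cases "s = t") auto
    show "- kr (- t) \<le> d" if "0 \<le> t" "t < 1" for t
      unfolding d_def using growth_le_infdist[OF assms(6) that] .
  qed auto
  have "((\<lambda>r. k (- of_real r)) \<longlongrightarrow> of_real (- l)) (at_left 1)"
  proof (rule Lim_transform_eventually)
    show "((\<lambda>r. of_real (- (- kr (- r)))) \<longlongrightarrow> complex_of_real (- l)) (at_left 1)"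
      by (intro tendsto_intros l)
    show "\<forall>\<^sub>F r in at_left 1. complex_of_real (- (- kr (- r))) = k (- of_real r)"
      by (rule eventually_at_leftI[of 0]) (use k_real[of "- r" for r] in auto)
  qed
  then have k_m1: "value_at_minus_one k = of_real (- l)"
    unfolding value_at_minus_one_def by (intro tendsto_Lim) simp
  have root_iff: "k (of_real s) + value_at_minus_one k = 0 \<longleftrightarrow> kr s = l" if "0 < s" "s < 1" for s
    unfolding k_m1 using k_real[of s] that by (simp add: complex_eq_iff)
  have "l > 0"
    using l(2)[of "1/2"] kr_strict_mono[of "- 1/2" 0] by (simp add: kr_0)
  \<comment> \<open>With this c, k(s) + k(-s) \<ge> 4 c s^2 \<ge> c for s \<ge> 1/2. An s > 1/2 with
    -k(-s) > l - c therefore has k(s) > l, and the intermediate value theorem gives a root below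
    s.\<close>
  define c where "c = Re (fps_nth (fps_expansion k 0) 2) / 2"
  have "c > 0" using k_coeff2_pos by (simp add: c_def)
  then have "\<forall>\<^sub>F r in at_left 1. l - c < - kr (- r)"
    using order_tendstoD(1)[OF l(1), of "l - c"] by simp
  moreover have "\<forall>\<^sub>F r in at_left 1. r \<in> {1/2<..<(1::real)}"
    by (rule eventually_at_leftI[of "1/2"]) auto
  ultimately have "\<forall>\<^sub>F r in at_left 1. l - c < - kr (- r) \<and> r \<in> {1/2<..<(1::real)}"
    by (rule eventually_conj)
  then obtain s where s: "l - c < - kr (- s)" "1/2 < s" "s < 1"
    using eventually_happens[of _ "at_left (1::real)"] by auto
  have "(1/2)\<^sup>2 \<le> s\<^sup>2" using s by (intro power_mono) auto
  then have "c \<le> 4 * c * s\<^sup>2" using \<open>c > 0\<close> by (simp add: power2_eq_square)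
  then have "l < kr s" using kr_add_kr_minus_ge[of s] s by (simp add: c_def)
  then obtain rf where rf: "0 \<le> rf" "rf \<le> s" "kr rf = l"
    using IVT[of kr 0 l s] \<open>l > 0\<close> s kr_0 DERIV_isCont[OF kr_deriv] by force
  have rf01: "0 < rf" "rf < 1" using rf s \<open>l > 0\<close> kr_0 by (auto simp: less_le)
  have "smallest_root k rf"
    unfolding smallest_root_def
  proof (intro conjI ballI impI)
    show "rf \<in> {0<..<1}" using rf01 by simp
    show "k (of_real rf) + value_at_minus_one k = 0" using root_iff[OF rf01] rf by simp
    fix s' :: real assume s': "s' \<in> {0<..<1}" "k (of_real s') + value_at_minus_one k = 0"
    then have "kr s' = l" using root_iff by simp
    \<comment> \<open>Strict monotonicity rules out a smaller root.\<close>
    then show "rf \<le> s'" using kr_strict_mono[of s' rf] rf rf01 s' by force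
  qed
  moreover have "norm z + (\<Sum>n. norm (a (n + 2)) * norm z ^ (n + 2)) \<le> d"
    if z: "norm z \<le> min rf (1/3)" for z :: complex
  proof -
    define r where "r = norm z"
    have r: "0 \<le> r" "r \<le> rf" "r \<le> 1/3" using z by (auto simp: r_def)
    have "kr r \<le> d"
      using kr_strict_mono[of r rf] r rf rf01 l(3) by (cases "r = rf") auto
    \<comment> \<open>The terms of index 0 and 1 contribute 0 and r, which is moved to the right.
      Boundedness of these partial sums also gives the summability behind the infinite sum.\<close>
    have part: "(\<Sum>n<M. norm (a (n + 2)) * r ^ (n + 2)) \<le> d - r" for M
      using bohr_sum_le[OF assms(6) r(1,3), of M] \<open>kr r \<le> d\<close>
      unfolding f_exp lessThan_Suc_atMost[symmetric] sum.lessThan_Suc_shift by simp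
    then have "summable (\<lambda>n. norm (a (n + 2)) * r ^ (n + 2))"
      using r by (intro summableI_nonneg_bounded[of _ "d - r"]) auto
    then have "(\<Sum>n. norm (a (n + 2)) * r ^ (n + 2)) \<le> d - r"
      using part by (intro suminf_le_const)
    then show ?thesis by (simp add: r_def)
  qed
  ultimately show ?thesis unfolding d_def by blast
qed

end
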